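(* Let $\beta_+,\beta_-\in[0,\pi)$ be such that $\beta=(\beta_++\beta_-)/\pi$ is not in $\frac12\mathbb{Z}$ or $\beta$ is such that the frequency spectrum $\{j-\beta:j\in\mathbb{Z}\}$ contains neither $0$ nor $\frac12$ (the two conditions are equivalent). Let $\mu\in(0,1)$, $\mu\neq\frac12$, be the lowest positive frequency in the spectrum of the massless Dirac field on $\mathrm{AdS}_2$ with the boundary conditions $\cos\beta_\pm\,\Phi^{(1)}(\pm\frac\pi2)=\mp\sin\beta_\pm\,\Phi^{(2)}(\pm\frac\pi2)$, and put $\lambda=\frac12\left(\mu-\frac12\right)^2$. Let $\hat L_\pm$ be the quantum charges on Fock space defined in the context, and let $|0\rangle$ be the Fock vacuum. Then $$[\hat L_+,\hat L_-]=2\hat L_0,\qquad \hat L_0=\sum_{j\ge0}\left(\omega_j\,a_j^\dagger a_j-\omega_{-j-1}\,b_j^\dagger b_j\right)+\lambda\,\mathbb{I},$$ and $$\hat L_0|0\rangle=\lambda|0\rangle,\qquad \hat L_-|0\rangle=0 .$$ Consequently the vacuum $|0\rangle$ is not invariant, and the representation it generates under $\hat L_0,\hat L_\pm$ is isomorphic to the discrete series representation $\mathscr{D}^+_\lambda$ with lowest-weight vector $|0\rangle$.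
   Context: Modes. Consider $\mathbb{D}\Phi=\omega\Phi$ on $[-\pi/2,\pi/2]$, $\mathbb{D}=\begin{pmatrix}0&-\frac{d}{d\rho}\\ \frac{d}{d\rho}&0\end{pmatrix}$, $\Phi=(\Phi^{(1)},\Phi^{(2)})^T$, with the stated boundary conditions. Its eigenvalues are the simple eigenvalues $\omega_j=\mu+j$, $j\in\mathbb{Z}$; let $\Psi_j(t,\rho)=\Phi_j(\rho)e^{-i\omega_jt}$ be the corresponding modes, normalized with respect to $\langle\Psi,\Psi'\rangle=\int_{-\pi/2}^{\pi/2}\Psi^\dagger\Psi'\,d\rho$ (they are orthonormal). The infinitesimal $\widetilde{\mathrm{SL}}(2,\mathbb{R})$ action is $L_0=i\partial_t$ and $$L_\pm=e^{\mp it}\Big(\pm i\cos\rho\,\partial_\rho\mp\tfrac{i}{2}\sin\rho+\sin\rho\,\partial_t+\cos\rho\,\Sigma^{01}\Big),\qquad \Sigma^{01}=\tfrac12\begin{pmatrix}0&i\\-i&0\end{pmatrix},$$ with $[L_0,L_\pm]=\pm L_\pm$, $[L_+,L_-]=2L_0$; $L_\pm\Psi_j$ is a multiple of $\Psi_{j\pm1}$. Fock space. Let $a_j,b_j$ ($j\ge0$) and their adjoints satisfy $\{a_j,a_k^\dagger\}=\delta_{jk}=\{b_j,b_k^\dagger\}$ with all other anticommutators zero, acting on the algebraic fermionic Fock space generated by the vacuum $|0\rangle$ with $a_j|0\rangle=b_j|0\rangle=0$ for all $j$. The quantum field is $\Psi=\sum_{j\ge0}(a_j\Psi_j+b_j^\dagger\Psi_{-j-1})$,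 i.e. $\Psi=\sum_{j\in\mathbb{Z}}c_j\Psi_j$ with $c_j=a_j$ for $j\ge0$ and $c_{-j-1}=b_j^\dagger$ for $j\ge0$. The charges are $\hat L_\pm=\langle\Psi,L_\pm\Psi\rangle:=\sum_{j,k\in\mathbb{Z}}\langle\Psi_j,L_\pm\Psi_k\rangle\,c_j^\dagger c_k$. For $\lambda>0$, $\mathscr{D}^+_\lambda$ denotes the irreducible unitary representation (with the raising/lowering operators satisfying $L_\pm^\dagger=-L_\mp$) whose $L_0$-eigenvalues are $\lambda+n$, $n\in\mathbb{N}\cup\{0\}$, each of multiplicity one, the eigenvector of eigenvalue $\lambda$ being annihilated by the lowering operator. *)

theory Defs
  imports "HOL-Analysis.Analysis" "HOL-Library.Groups_Big_Fun"
begin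

section \<open>Massless Dirac modes on the strip\<close>

abbreviation strip :: "real set" where
  "strip \<equiv> {- pi / 2 .. pi / 2}"

text \<open>Derivatives in \<open>\<rho>\<close> are taken relative to the closed strip, i.e. one-sided at its
  end points.\<close>

definition d_rho :: "(real \<Rightarrow> complex^2) \<Rightarrow> real \<Rightarrow> complex^2" where
  "d_rho \<Phi> \<rho> = vector_derivative \<Phi> (at \<rho> within strip)"

definition dirac_op :: "(real \<Rightarrow> complex^2) \<Rightarrow> real \<Rightarrow> complex^2" where
  "dirac_op \<Phi> \<rho> = vector [- (d_rho \<Phi> \<rho> $ 2), d_rho \<Phi> \<rho> $ 1]"

definition dirac_bc :: "real \<Rightarrow> real \<Rightarrow> (real \<Rightarrow> complex^2) \<Rightarrow> bool" where
  "dirac_bc \<beta>p \<beta>m \<Phi> \<longleftrightarrow>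
     of_real (cos \<beta>p) * \<Phi> (pi / 2) $ 1 = - of_real (sin \<beta>p) * \<Phi> (pi / 2) $ 2 \<and>
     of_real (cos \<beta>m) * \<Phi> (- pi / 2) $ 1 = of_real (sin \<beta>m) * \<Phi> (- pi / 2) $ 2"

definition dirac_eigenfunction ::
    "real \<Rightarrow> real \<Rightarrow> real \<Rightarrow> (real \<Rightarrow> complex^2) \<Rightarrow> bool" where
  "dirac_eigenfunction \<beta>p \<beta>m \<omega> \<Phi> \<longleftrightarrow>
     (\<forall>\<rho>\<in>strip. \<Phi> differentiable (at \<rho> within strip)) \<and>
     (\<forall>\<rho>\<in>strip. dirac_op \<Phi> \<rho> = of_real \<omega> *s \<Phi> \<rho>) \<and>
     dirac_bc \<beta>p \<beta>m \<Phi> \<and>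
     (\<exists>\<rho>\<in>strip. \<Phi> \<rho> \<noteq> 0)"

definition frequency_spectrum :: "real \<Rightarrow> real \<Rightarrow> real set" where
  "frequency_spectrum \<beta>p \<beta>m = {\<omega>. \<exists>\<Phi>. dirac_eigenfunction \<beta>p \<beta>m \<omega> \<Phi>}"

definition lowest_positive_frequency :: "real \<Rightarrow> real \<Rightarrow> real \<Rightarrow> bool" where
  "lowest_positive_frequency \<beta>p \<beta>m \<mu> \<longleftrightarrow>
     \<mu> \<in> frequency_spectrum \<beta>p \<beta>m \<and> 0 < \<mu> \<and>
     (\<forall>\<omega>\<in>frequency_spectrum \<beta>p \<beta>m. 0 < \<omega> \<longrightarrow> \<mu> \<le> \<omega>)"

text \<open>Space-time spinor fields have type \<open>real \<Rightarrow> real \<Rightarrow> complex^2\<close>; the first argument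
  is the time \<open>t\<close>, the second one is \<open>\<rho>\<close>.\<close>

definition mode :: "real \<Rightarrow> (real \<Rightarrow> complex^2) \<Rightarrow> real \<Rightarrow> real \<Rightarrow> complex^2" where
  "mode \<omega> \<Phi> t \<rho> = exp (- \<i> * of_real (\<omega> * t)) *s \<Phi> \<rho>"

definition spinor_ip ::
    "real \<Rightarrow> (real \<Rightarrow> real \<Rightarrow> complex^2) \<Rightarrow> (real \<Rightarrow> real \<Rightarrow> complex^2) \<Rightarrow> complex" where
  "spinor_ip t \<Psi> \<Psi>' = integral strip (\<lambda>\<rho>. \<Sum>i\<in>UNIV. cnj (\<Psi> t \<rho> $ i) * \<Psi>' t \<rho> $ i)"

definition Sigma01 :: "complex^2^2" where
  "Sigma01 = vector [vector [0, \<i> / 2], vector [- \<i> / 2, 0]]"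

text \<open>\<open>L_shift s\<close> is \<open>L\<^sub>+\<close> for \<open>s = 1\<close> and \<open>L\<^sub>-\<close> for \<open>s = - 1\<close>.\<close>

definition L_shift ::
    "real \<Rightarrow> (real \<Rightarrow> real \<Rightarrow> complex^2) \<Rightarrow> real \<Rightarrow> real \<Rightarrow> complex^2" where
  "L_shift s \<Psi> t \<rho> =
     exp (- \<i> * of_real (s * t)) *s
       ((\<i> * of_real (s * cos \<rho>)) *s d_rho (\<Psi> t) \<rho>
        - (\<i> / 2 * of_real (s * sin \<rho>)) *s \<Psi> t \<rho>
        + of_real (sin \<rho>) *s vector_derivative (\<lambda>\<tau>. \<Psi> \<tau> \<rho>) (at t)
        + of_real (cos \<rho>) *s (Sigma01 *v \<Psi> t \<rho>))"

abbreviation "L_plus \<equiv> L_shift 1"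
abbreviation "L_minus \<equiv> L_shift (- 1)"


section \<open>Fermionic Fock space\<close>

text \<open>Inner products are antilinear in the first argument.\<close>

locale complex_inner_space = vector_space smul
  for smul :: "complex \<Rightarrow> 'v::ab_group_add \<Rightarrow> 'v" +
  fixes ip :: "'v \<Rightarrow> 'v \<Rightarrow> complex"
  assumes ip_hermitian: "ip x y = cnj (ip y x)"
    and ip_add_right: "ip x (y + z) = ip x y + ip x z"
    and ip_scale_right: "ip x (smul c y) = c * ip x y"
    and ip_nonneg: "0 \<le> Re (ip x x)"
    and ip_definite: "ip x x = 0 \<Longrightarrow> x = 0"

text \<open>The type \<open>'v\<close> is the whole algebraic Fock space; no completion is involved, by
  \<open>cyclic\<close>.\<close>

locale fermionic_fock = complex_inner_space smul ip
  for smul :: "complex \<Rightarrow> 'v::ab_group_add \<Rightarrow> 'v" and ip :: "'v \<Rightarrow> 'v \<Rightarrow> complex" +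
  fixes a adag b bdag :: "nat \<Rightarrow> 'v \<Rightarrow> 'v" and vac :: 'v
  assumes linear_ops:
      "Vector_Spaces.linear smul smul (a j)" "Vector_Spaces.linear smul smul (adag j)"
      "Vector_Spaces.linear smul smul (b j)" "Vector_Spaces.linear smul smul (bdag j)"
    and adjoints:
      "ip (a j x) y = ip x (adag j y)"
      "ip (b j x) y = ip x (bdag j y)"
    and car_delta:
      "a j (adag k x) + adag k (a j x) = (if j = k then x else 0)"
      "b j (bdag k x) + bdag k (b j x) = (if j = k then x else 0)"
    and car_zero:
      "a j (a k x) + a k (a j x) = 0"
      "adag j (adag k x) + adag k (adag j x) = 0"
      "b j (b k x) + b k (b j x) = 0"
      "bdag j (bdag k x) + bdag k (bdag j x) = 0"
      "a j (b k x) + b k (a j x) = 0"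
      "a j (bdag k x) + bdag k (a j x) = 0"
      "adag j (b k x) + b k (adag j x) = 0"
      "adag j (bdag k x) + bdag k (adag j x) = 0"
    and vac_unit: "ip vac vac = 1"
    and vac_annihilated: "a j vac = 0" "b j vac = 0"
    and cyclic:
      "\<lbrakk>subspace W; vac \<in> W;
        \<And>j x. x \<in> W \<Longrightarrow> a j x \<in> W \<and> adag j x \<in> W \<and> b j x \<in> W \<and> bdag j x \<in> W\<rbrakk>
       \<Longrightarrow> W = UNIV"

text \<open>\<open>field_coeff a bdag k\<close> is \<open>c\<^sub>k\<close>, and \<open>field_coeff adag b k\<close> is its adjoint.\<close>

definition field_coeff :: "(nat \<Rightarrow> 'v \<Rightarrow> 'v) \<Rightarrow> (nat \<Rightarrow> 'v \<Rightarrow> 'v) \<Rightarrow> int \<Rightarrow> 'v \<Rightarrow> 'v" where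
  "field_coeff x y k = (if 0 \<le> k then x (nat k) else y (nat (- k - 1)))"

text \<open>The charge of a one-particle operator \<open>L\<close> at time \<open>t\<close>, for the modes \<open>\<Psi>\<^sub>j\<close>.
  The infinite sum over \<open>j, k\<close> is evaluated on each Fock vector separately: \<open>Sum_any\<close> adds up
  the nonzero terms, and has its intended meaning where these are finite in number.\<close>

definition charge_term ::
    "(complex \<Rightarrow> 'v \<Rightarrow> 'v) \<Rightarrow> (nat \<Rightarrow> 'v \<Rightarrow> 'v) \<Rightarrow> (nat \<Rightarrow> 'v \<Rightarrow> 'v) \<Rightarrow>
     (nat \<Rightarrow> 'v \<Rightarrow> 'v) \<Rightarrow> (nat \<Rightarrow> 'v \<Rightarrow> 'v) \<Rightarrow> real \<Rightarrow> (int \<Rightarrow> real \<Rightarrow> real \<Rightarrow> complex^2) \<Rightarrow>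
     ((real \<Rightarrow> real \<Rightarrow> complex^2) \<Rightarrow> real \<Rightarrow> real \<Rightarrow> complex^2) \<Rightarrow> 'v \<Rightarrow> int \<times> int \<Rightarrow> 'v" where
  "charge_term smul a adag b bdag t \<Psi> L v = (\<lambda>(j, k).
     smul (spinor_ip t (\<Psi> j) (L (\<Psi> k))) (field_coeff adag b j (field_coeff a bdag k v)))"

definition charge ::
    "(complex \<Rightarrow> 'v \<Rightarrow> 'v::ab_group_add) \<Rightarrow> (nat \<Rightarrow> 'v \<Rightarrow> 'v) \<Rightarrow> (nat \<Rightarrow> 'v \<Rightarrow> 'v) \<Rightarrow>
     (nat \<Rightarrow> 'v \<Rightarrow> 'v) \<Rightarrow> (nat \<Rightarrow> 'v \<Rightarrow> 'v) \<Rightarrow> real \<Rightarrow> (int \<Rightarrow> real \<Rightarrow> real \<Rightarrow> complex^2) \<Rightarrow>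
     ((real \<Rightarrow> real \<Rightarrow> complex^2) \<Rightarrow> real \<Rightarrow> real \<Rightarrow> complex^2) \<Rightarrow> 'v \<Rightarrow> 'v" where
  "charge smul a adag b bdag t \<Psi> L v = Sum_any (charge_term smul a adag b bdag t \<Psi> L v)"

definition energy_term ::
    "(complex \<Rightarrow> 'v \<Rightarrow> 'v::ab_group_add) \<Rightarrow> (nat \<Rightarrow> 'v \<Rightarrow> 'v) \<Rightarrow> (nat \<Rightarrow> 'v \<Rightarrow> 'v) \<Rightarrow>
     (nat \<Rightarrow> 'v \<Rightarrow> 'v) \<Rightarrow> (nat \<Rightarrow> 'v \<Rightarrow> 'v) \<Rightarrow> (int \<Rightarrow> real) \<Rightarrow> 'v \<Rightarrow> nat \<Rightarrow> 'v" where
  "energy_term smul a adag b bdag \<omega> v j =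
     smul (of_real (\<omega> (int j))) (adag j (a j v))
     - smul (of_real (\<omega> (- int j - 1))) (bdag j (b j v))"


section \<open>Unitary lowest-weight representations\<close>

text \<open>A representation lives on a subspace \<open>rep_space\<close> of an ambient complex inner product
  space; \<open>rep_L0\<close>, \<open>rep_Lp\<close>, \<open>rep_Lm\<close> only matter on \<open>rep_space\<close>.\<close>

record 'v sl2_rep =
  rep_scale :: "complex \<Rightarrow> 'v \<Rightarrow> 'v"
  rep_ip :: "'v \<Rightarrow> 'v \<Rightarrow> complex"
  rep_space :: "'v set"
  rep_L0 :: "'v \<Rightarrow> 'v"
  rep_Lp :: "'v \<Rightarrow> 'v"
  rep_Lm :: "'v \<Rightarrow> 'v"

definition linear_map_on ::
    "(complex \<Rightarrow> 'v::ab_group_add \<Rightarrow> 'v) \<Rightarrow> (complex \<Rightarrow> 'w::ab_group_add \<Rightarrow> 'w) \<Rightarrow>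
     'v set \<Rightarrow> ('v \<Rightarrow> 'w) \<Rightarrow> bool" where
  "linear_map_on s s' V T \<longleftrightarrow>
     (\<forall>x\<in>V. \<forall>y\<in>V. T (x + y) = T x + T y) \<and> (\<forall>c. \<forall>x\<in>V. T (s c x) = s' c (T x))"

definition invariant_subspace :: "'v::ab_group_add sl2_rep \<Rightarrow> 'v set \<Rightarrow> bool" where
  "invariant_subspace R W \<longleftrightarrow> module.subspace (rep_scale R) W \<and>
     (\<forall>x\<in>W. rep_L0 R x \<in> W \<and> rep_Lp R x \<in> W \<and> rep_Lm R x \<in> W)"

definition unitary_sl2_rep :: "'v::ab_group_add sl2_rep \<Rightarrow> bool" where
  "unitary_sl2_rep R \<longleftrightarrow>
     complex_inner_space (rep_scale R) (rep_ip R) \<and>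
     invariant_subspace R (rep_space R) \<and>
     linear_map_on (rep_scale R) (rep_scale R) (rep_space R) (rep_L0 R) \<and>
     linear_map_on (rep_scale R) (rep_scale R) (rep_space R) (rep_Lp R) \<and>
     linear_map_on (rep_scale R) (rep_scale R) (rep_space R) (rep_Lm R) \<and>
     (\<forall>x\<in>rep_space R.
        rep_L0 R (rep_Lp R x) - rep_Lp R (rep_L0 R x) = rep_Lp R x \<and>
        rep_L0 R (rep_Lm R x) - rep_Lm R (rep_L0 R x) = - rep_Lm R x \<and>
        rep_Lp R (rep_Lm R x) - rep_Lm R (rep_Lp R x) = rep_scale R 2 (rep_L0 R x)) \<and>
     (\<forall>x\<in>rep_space R. \<forall>y\<in>rep_space R.
        rep_ip R (rep_L0 R x) y = rep_ip R x (rep_L0 R y) \<and>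
        rep_ip R (rep_Lp R x) y = - rep_ip R x (rep_Lm R y))"

definition irreducible_sl2_rep :: "'v::ab_group_add sl2_rep \<Rightarrow> bool" where
  "irreducible_sl2_rep R \<longleftrightarrow> rep_space R \<noteq> {0} \<and>
     (\<forall>W. invariant_subspace R W \<and> W \<subseteq> rep_space R \<longrightarrow> W = {0} \<or> W = rep_space R)"

definition L0_eigenspace :: "'v sl2_rep \<Rightarrow> complex \<Rightarrow> 'v set" where
  "L0_eigenspace R z = {v \<in> rep_space R. rep_L0 R v = rep_scale R z v}"

definition L0_eigenvalues :: "'v::ab_group_add sl2_rep \<Rightarrow> complex set" where
  "L0_eigenvalues R = {z. \<exists>v\<in>L0_eigenspace R z. v \<noteq> 0}"

definition lowest_weight_vector :: "'v::ab_group_add sl2_rep \<Rightarrow> real \<Rightarrow> 'v \<Rightarrow> bool" where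
  "lowest_weight_vector R lam v \<longleftrightarrow>
     v \<in> L0_eigenspace R (of_real lam) \<and> v \<noteq> 0 \<and> rep_Lm R v = 0"

text \<open>\<open>R\<close> is a realization of \<open>\<D>\<^sup>+\<close> with lowest weight \<open>lam\<close>.\<close>

definition discrete_series_plus :: "real \<Rightarrow> 'v::ab_group_add sl2_rep \<Rightarrow> bool" where
  "discrete_series_plus lam R \<longleftrightarrow>
     0 < lam \<and> unitary_sl2_rep R \<and> irreducible_sl2_rep R \<and>
     L0_eigenvalues R = {of_real (lam + real n) | n. True} \<and>
     (\<forall>z\<in>L0_eigenvalues R. vector_space.dim (rep_scale R) (L0_eigenspace R z) = 1) \<and>
     (\<forall>v\<in>L0_eigenspace R (of_real lam). rep_Lm R v = 0)"

definition unitary_equivalence ::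
    "'v::ab_group_add sl2_rep \<Rightarrow> 'w::ab_group_add sl2_rep \<Rightarrow> ('v \<Rightarrow> 'w) \<Rightarrow> bool" where
  "unitary_equivalence R S U \<longleftrightarrow>
     bij_betw U (rep_space R) (rep_space S) \<and>
     linear_map_on (rep_scale R) (rep_scale S) (rep_space R) U \<and>
     (\<forall>x\<in>rep_space R. \<forall>y\<in>rep_space R. rep_ip S (U x) (U y) = rep_ip R x y) \<and>
     (\<forall>x\<in>rep_space R. U (rep_L0 R x) = rep_L0 S (U x) \<and>
        U (rep_Lp R x) = rep_Lp S (U x) \<and> U (rep_Lm R x) = rep_Lm S (U x))"

definition generated_rep :: "'v::ab_group_add sl2_rep \<Rightarrow> 'v \<Rightarrow> 'v sl2_rep" where
  "generated_rep R v = R\<lparr>rep_space := \<Inter>{W. invariant_subspace R W \<and> v \<in> W}\<rparr>"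

text \<open>Invariance of a vector under the group, expressed by the generators.\<close>

definition invariant_vector :: "'v::ab_group_add sl2_rep \<Rightarrow> 'v \<Rightarrow> bool" where
  "invariant_vector R v \<longleftrightarrow> rep_L0 R v = 0 \<and> rep_Lp R v = 0 \<and> rep_Lm R v = 0"

end

theory Submission
  imports Defs
begin

text \<open>On the strip a mode is a constant times \<open>(sin x, cos x)\<close> with \<open>x = \<omega> (\<rho> + \<pi>/2) + \<beta>\<^sub>-\<close>, so that \<open>L\<^sub>\<plusminus>\<close>
  shifts modes with coefficients of modulus \<open>\<bar>\<omega> \<plusminus> 1/2\<bar>\<close>. Every Fock vector sees the charges only through
  finitely many modes. On a window \<open>- N \<le> k < N\<close> the commutator of the charges is a sum by parts of
  \<open>(\<omega>\<^sub>k + 1/2)\<^sup>2 (c\<^sub>k\<^sup>\<dagger> c\<^sub>k - c\<^sub>k\<^sub>+\<^sub>1\<^sup>\<dagger> c\<^sub>k\<^sub>+\<^sub>1)\<close>, and the boundary term from the filled Dirac sea produces the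
  constant \<open>\<lambda>\<close>. The vacuum then is a lowest-weight vector, and positivity of \<open>\<lambda>\<close> fixes the
  representation that it generates.\<close>

section \<open>Unitary lowest-weight representations\<close>

text \<open>The energy cannot be defined as a third charge: its matrix elements are diagonal, so on
  the vacuum every filled mode \<open>k < 0\<close> would contribute \<open>\<omega> k\<close>,
  infinitely many nonzero terms. The shift charges escape this, since moving a quantum between
  neighbouring modes gives zero deep in the filled sea as well as far above it. Hence
  \<open>L0\<close> is taken to be the normal-ordered energy plus a constant, and the relation
  \<open>[Lp, Lm] = 2 L0\<close> fixes that constant. With
  \<open>P k = (\<omega> k + 1/2)\<^sup>2\<close> one has
  \<open>P k - P (k - 1) = 2 * \<omega> k\<close>, so the sea energies over
  \<open>- N \<le> k < 0\<close> together with \<open>P (- N - 1) / 2\<close> telescope to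
  \<open>P (- 1) / 2\<close>, which is \<open>lam\<close> whatever \<open>N\<close> is.

  Normalization leaves a free phase in each mode, so the coefficients of \<open>Lp\<close> are not
  determined. Only their squared moduli are, and these suffice: the phases cancel in
  \<open>[Lp, Lm]\<close>, and \<open>[L0, Lp] = Lp\<close> holds for any coefficients.\<close>

context complex_inner_space
begin

section \<open>Inner products and spans\<close>

lemma ip_add_left: "ip (x + y) z = ip x z + ip y z"
  by (metis complex_cnj_add ip_add_right ip_hermitian)

lemma ip_scale_left: "ip (smul c x) y = cnj c * ip x y"
  by (metis complex_cnj_mult ip_scale_right ip_hermitian)

lemma ip_zero [simp]: "ip x 0 = 0" "ip 0 x = 0"
  using ip_add_right[of x 0 0] ip_add_left[of 0 0 x] by auto

lemma ip_minus_right: "ip x (- y) = - ip x y"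
  using ip_add_right[of x y "- y"] by (simp add: eq_neg_iff_add_eq_0 add.commute)

lemma ip_minus_left: "ip (- x) y = - ip x y"
  using ip_add_left[of x "- x" y] by (simp add: eq_neg_iff_add_eq_0 add.commute)

lemma ip_diff_right: "ip x (y - z) = ip x y - ip x z"
  using ip_add_right[of x y "- z"] by (simp add: ip_minus_right)

lemma ip_diff_left: "ip (x - y) z = ip x z - ip y z"
  using ip_add_left[of x "- y" z] by (simp add: ip_minus_left)

lemma ip_sum_right: "ip x (\<Sum>i\<in>I. f i) = (\<Sum>i\<in>I. ip x (f i))"
  by (induction I rule: infinite_finite_induct) (simp_all add: ip_add_right)

lemma ip_sum_left: "ip (\<Sum>i\<in>I. f i) x = (\<Sum>i\<in>I. ip (f i) x)"
  by (induction I rule: infinite_finite_induct) (simp_all add: ip_add_left)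

lemma ip_self_real: "ip x x = of_real (Re (ip x x))"
  using ip_hermitian[of x x] by (simp add: complex_eq_iff)

lemma ip_self_pos: "x \<noteq> 0 \<Longrightarrow> 0 < Re (ip x x)"
  by (metis ip_self_real ip_definite ip_nonneg less_le of_real_0)

text \<open>Span induction that remembers \<open>y \<in> span S\<close>. Representation operators
  are linear only on \<open>rep_space R\<close>, so an inductive step may split an image only when
  both summands are known to lie there.\<close>

lemma span_induct_mem [consumes 1, case_names base step]:
  assumes "x \<in> span S" "P 0"
    and "\<And>c x y. x \<in> S \<Longrightarrow> y \<in> span S \<Longrightarrow> P y \<Longrightarrow> P (smul c x + y)"
  shows "P x"
proof -
  have "x \<in> span S \<and> P x"
    using assms(1)
    by (induction rule: span_induct_alt)
      (auto simp: assms(2,3) span_zero intro: span_add span_scale span_base)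
  then show ?thesis ..
qed

text \<open>Being in the span itself, \<open>x\<close> is orthogonal to itself; definiteness
  finishes.\<close>

lemma orthogonal_to_span:
  assumes "x \<in> span S" and "\<And>y. y \<in> S \<Longrightarrow> ip y x = 0"
  shows "x = 0"
proof -
  have "ip y x = 0" if "y \<in> span S" for y
    using that by (induction rule: span_induct_alt) (simp_all add: ip_add_left ip_scale_left assms(2))
  then show ?thesis
    using assms(1) ip_definite by blast
qed

lemma eq_if_ip_eq: "(\<And>y. ip x y = ip z y) \<Longrightarrow> x = z"
  by (metis eq_iff_diff_eq_0 ip_definite ip_diff_left)

end

section \<open>The orbit of a lowest-weight vector under the raising operator\<close>

locale lowest_weight_rep = complex_inner_space "rep_scale R" "rep_ip R"
  for R :: "'v::ab_group_add sl2_rep" +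
  fixes lam :: real and v :: 'v
  assumes unitary: "unitary_sl2_rep R"
    and lowest: "lowest_weight_vector R lam v"
    and lam_pos: "0 < lam"
begin

abbreviation "sc \<equiv> rep_scale R"
abbreviation "V \<equiv> rep_space R"
abbreviation "L0 \<equiv> rep_L0 R"
abbreviation "Lp \<equiv> rep_Lp R"
abbreviation "Lm \<equiv> rep_Lm R"
abbreviation "inn \<equiv> rep_ip R"

text \<open>The weight vectors stay unnormalized, so that \<open>Lp\<close> is the plain shift and
  two such orbits can be matched without normalization constants.\<close>

definition e :: "nat \<Rightarrow> 'v" where
  "e n = (Lp ^^ n) v"

lemma e_0 [simp]: "e 0 = v" and e_Suc: "e (Suc n) = Lp (e n)"
  by (simp_all add: e_def)

lemma subspace_V: "subspace V"
  and V_closed: "x \<in> V \<Longrightarrow> L0 x \<in> V" "x \<in> V \<Longrightarrow> Lp x \<in> V" "x \<in> V \<Longrightarrow> Lm x \<in> V"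
  using unitary unfolding unitary_sl2_rep_def invariant_subspace_def by blast+

lemma ops_add:
  assumes "x \<in> V" "y \<in> V"
  shows "L0 (x + y) = L0 x + L0 y" "Lp (x + y) = Lp x + Lp y" "Lm (x + y) = Lm x + Lm y"
  using unitary assms unfolding unitary_sl2_rep_def linear_map_on_def by blast+

lemma ops_scale:
  assumes "x \<in> V"
  shows "L0 (sc c x) = sc c (L0 x)" "Lp (sc c x) = sc c (Lp x)" "Lm (sc c x) = sc c (Lm x)"
  using unitary assms unfolding unitary_sl2_rep_def linear_map_on_def by blast+

lemma ops_zero [simp]: "L0 0 = 0" "Lp 0 = 0" "Lm 0 = 0"
  using ops_scale[of 0 0] subspace_V by (auto simp: subspace_def)

lemma comms:
  assumes "x \<in> V"
  shows "L0 (Lp x) = Lp (L0 x) + Lp x" "L0 (Lm x) = Lm (L0 x) - Lm x"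
    "Lm (Lp x) = Lp (Lm x) - sc 2 (L0 x)"
  using unitary assms unfolding unitary_sl2_rep_def by (auto simp: algebra_simps)

lemma adj:
  assumes "x \<in> V" "y \<in> V"
  shows "inn (L0 x) y = inn x (L0 y)" "inn (Lp x) y = - inn x (Lm y)"
  using unitary assms unfolding unitary_sl2_rep_def by auto

lemma v_props: "v \<in> V" "L0 v = sc (of_real lam) v" "v \<noteq> 0" "Lm v = 0"
  using lowest unfolding lowest_weight_vector_def L0_eigenspace_def by auto

lemma e_in: "e n \<in> V"
  by (induction n) (auto simp: v_props V_closed e_Suc)

lemma span_e_sub: "span (range e) \<subseteq> V"
  using e_in subspace_V by (intro span_minimal) auto

lemma L0_e: "L0 (e n) = sc (of_real (lam + real n)) (e n)"
proof (induction n)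
  case 0
  then show ?case by (simp add: v_props)
next
  case (Suc n)
  then show ?case
    by (simp add: e_Suc comms e_in ops_add ops_scale V_closed subspace_scale[OF subspace_V]
        scale_left_distrib)
qed

text \<open>Each passage of \<open>Lm\<close> across a factor \<open>Lp\<close> costs
  \<open>- 2 L0\<close>, so the coefficient is minus the sum of \<open>2 * (lam + k)\<close> over
  \<open>k = 0, ..., n\<close>. It is negative because the adjoint of \<open>Lp\<close> is
  \<open>- Lm\<close>.\<close>

lemma Lm_e_Suc: "Lm (e (Suc n)) = sc (- of_real ((real n + 1) * (2 * lam + real n))) (e n)"
proof (induction n)
  case 0
  then show ?case
    by (simp add: e_Suc comms v_props L0_e algebra_simps)
next
  case (Suc n)
  have "Lm (e (Suc (Suc n))) = Lp (Lm (e (Suc n))) - sc 2 (L0 (e (Suc n)))"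
    using comms(3)[OF e_in, of "Suc n"] by (simp add: e_Suc)
  also have "\<dots> = sc (- of_real ((real n + 1) * (2 * lam + real n))
                   - 2 * of_real (lam + real (Suc n))) (e (Suc n))"
    by (simp only: Suc.IH ops_scale e_in L0_e e_Suc[symmetric] scale_scale scale_left_diff_distrib)
  also have "- of_real ((real n + 1) * (2 * lam + real n)) - 2 * of_real (lam + real (Suc n))
      = (- of_real ((real (Suc n) + 1) * (2 * lam + real (Suc n))) :: complex)"
    by (simp add: complex_eq_iff algebra_simps)
  finally show ?case .
qed

lemma norm_e: "inn (e n) (e n) =
    of_real (\<Prod>k<n. (real k + 1) * (2 * lam + real k)) * inn v v"
proof (induction n)
  case (Suc n)
  have "inn (e (Suc n)) (e (Suc n)) = - inn (e n) (Lm (e (Suc n)))"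
    using adj(2)[OF e_in e_in, of n "Suc n"] by (simp add: e_Suc)
  also have "\<dots> = of_real ((real n + 1) * (2 * lam + real n)) * inn (e n) (e n)"
    by (simp only: Lm_e_Suc ip_scale_right)  simp
  finally show ?case
    using Suc.IH by (simp add: algebra_simps)
qed simp

text \<open>Positivity of \<open>lam\<close> is essential: at \<open>lam = 0\<close> the factor
  \<open>k = 0\<close> vanishes and the orbit stops at \<open>v\<close>.\<close>

lemma e_nonzero: "e n \<noteq> 0"
proof -
  have "(\<Prod>k<n. (real k + 1) * (2 * lam + real k)) \<noteq> 0"
    using lam_pos by (auto simp: prod_zero_iff add_nonneg_eq_0_iff)
  then have "(of_real (\<Prod>k<n. (real k + 1) * (2 * lam + real k)) :: complex) \<noteq> 0"
    using of_real_eq_0_iff by blast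
  moreover have "inn v v \<noteq> 0"
    using ip_definite v_props by blast
  ultimately have "inn (e n) (e n) \<noteq> 0"
    unfolding norm_e mult_eq_0_iff by blast
  then show ?thesis by auto
qed

lemma inn_e_neq:
  assumes "m \<noteq> n"
  shows "inn (e m) (e n) = 0"
proof -
  have "inn (L0 (e m)) (e n) = inn (e m) (L0 (e n))"
    by (rule adj(1)[OF e_in e_in])
  then have "of_real (lam + real m) * inn (e m) (e n) = of_real (lam + real n) * inn (e m) (e n)"
    by (simp add: L0_e ip_scale_left ip_scale_right)
  moreover have "(of_real (lam + real m) :: complex) \<noteq> of_real (lam + real n)"
    using assms of_real_eq_iff by fastforce
  ultimately show ?thesis by (metis mult_right_cancel)
qed

lemma e_in_span: "e n \<in> span (range e)"
  by (intro span_base) simp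

lemma v_in_span: "v \<in> span (range e)"
  using e_in_span[of 0] by simp

lemma invariant_span_e: "invariant_subspace R (span (range e))"
proof -
  \<comment> \<open>Stated for an arbitrary \<open>T\<close> so that one induction serves all three
    operators.\<close>
  have closed: "T x \<in> span (range e)"
    if "T 0 = 0" and T: "\<And>x y. x \<in> V \<Longrightarrow> y \<in> V \<Longrightarrow> T (x + y) = T x + T y"
      "\<And>c x. x \<in> V \<Longrightarrow> T (sc c x) = sc c (T x)"
      and T_e: "\<And>n. T (e n) \<in> span (range e)"
      and "x \<in> span (range e)" for T x
    using \<open>x \<in> span (range e)\<close>
  proof (induction rule: span_induct_mem)
    case (step c x y)
    then obtain n where n: "x = e n" by blast
    have "y \<in> V" using step span_e_sub by blast
    then have "T (sc c x + y) = sc c (T (e n)) + T y"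
      unfolding n using T(1)[OF subspace_scale[OF subspace_V e_in]] T(2)[OF e_in] by simp
    then show ?case
      using T_e[of n] step span_add span_scale by simp
  qed (simp add: span_zero \<open>T 0 = 0\<close>)
  have "L0 (e n) \<in> span (range e)" "Lp (e n) \<in> span (range e)" "Lm (e n) \<in> span (range e)" for n
  proof -
    show "L0 (e n) \<in> span (range e)"
      unfolding L0_e by (intro span_scale e_in_span)
    show "Lp (e n) \<in> span (range e)"
      unfolding e_Suc[symmetric] by (rule e_in_span)
    show "Lm (e n) \<in> span (range e)"
    proof (cases n)
      case 0
      then show ?thesis by (simp add: v_props span_zero)
    next
      case (Suc m)
      then show ?thesis
        unfolding Suc Lm_e_Suc by (intro span_scale e_in_span)
    qed
  qed
  then show ?thesis
    unfolding invariant_subspace_def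
    using closed[of L0] closed[of Lp] closed[of Lm] ops_zero ops_add ops_scale subspace_span
    by blast
qed

lemma span_e_least:
  assumes "invariant_subspace R W" "v \<in> W"
  shows "span (range e) \<subseteq> W"
proof -
  have "e n \<in> W" for n
    by (induction n) (use assms in \<open>auto simp: e_Suc invariant_subspace_def\<close>)
  then show ?thesis
    using assms by (intro span_minimal) (auto simp: invariant_subspace_def)
qed

lemma generated_eq: "generated_rep R v = R\<lparr>rep_space := span (range e)\<rparr>"
proof -
  have "\<Inter>{W. invariant_subspace R W \<and> v \<in> W} = span (range e)"
    using span_e_least invariant_span_e v_in_span by blast
  then show ?thesis by (simp add: generated_rep_def)
qed

text \<open>\<open>Lm\<close> lowers the index and kills \<open>e 0\<close>. The claim covers all
  large powers, so that the bounds for two summands combine by a maximum.\<close>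

lemma Lm_nilpotent:
  assumes "x \<in> span (range e)"
  shows "\<exists>N. \<forall>n\<ge>N. (Lm ^^ n) x = 0"
proof -
  have pow_V: "(Lm ^^ n) x \<in> V" if "x \<in> V" for n x
    by (induction n) (simp_all add: V_closed that)
  have pow_lin: "(Lm ^^ n) (sc c x + y) = sc c ((Lm ^^ n) x) + (Lm ^^ n) y"
    if "x \<in> V" "y \<in> V" for n c x y
    by (induction n) (simp_all add: pow_V that ops_add ops_scale subspace_scale[OF subspace_V])
  have pow_0: "(Lm ^^ n) 0 = 0" for n
    by (induction n) simp_all
  have *: "(Lm ^^ Suc n) (e n) = 0" for n
  proof (induction n)
    case (Suc n)
    have "(Lm ^^ Suc (Suc n)) (e (Suc n)) = (Lm ^^ Suc n) (Lm (e (Suc n)))"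
      by (simp only: funpow_Suc_right o_apply)
    also have "\<dots> = sc (- of_real ((real n + 1) * (2 * lam + real n))) ((Lm ^^ Suc n) (e n))"
      using pow_lin[OF e_in subspace_0[OF subspace_V], of "Suc n"]
      by (simp only: Lm_e_Suc pow_0 add_0_right)
    finally show ?case by (simp only: Suc.IH scale_zero_right)
  qed (simp add: v_props)
  have **: "(Lm ^^ m) (e n) = 0" if "m \<ge> Suc n" for m n
  proof -
    have "(Lm ^^ m) (e n) = (Lm ^^ (m - Suc n)) ((Lm ^^ Suc n) (e n))"
      using that by (metis comp_apply funpow_add le_add_diff_inverse2)
    then show ?thesis by (simp only: * pow_0)
  qed
  show ?thesis
    using assms
  proof (induction rule: span_induct_mem)
    case base
    then show ?case by (simp add: pow_0)
  next
    case (step c x y)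
    then obtain k N where "x = e k" "\<forall>n\<ge>N. (Lm ^^ n) y = 0" by blast
    then have "\<forall>n\<ge>max (Suc k) N. (Lm ^^ n) (sc c x + y) = 0"
      using pow_lin[OF e_in, of y] step span_e_sub ** by (auto simp: subsetD)
    then show ?case by blast
  qed
qed

text \<open>After subtracting its projection onto \<open>e n\<close>, the vector is orthogonal to
  the whole orbit and hence zero.\<close>

lemma eq_multiple_of_e:
  assumes x: "x \<in> span (range e)" and orth: "\<And>m. m \<noteq> n \<Longrightarrow> inn (e m) x = 0"
  shows "\<exists>c. x = sc c (e n)"
proof -
  define c where "c = inn (e n) x / inn (e n) (e n)"
  have "x - sc c (e n) = 0"
  proof (rule orthogonal_to_span)
    show "x - sc c (e n) \<in> span (range e)"
      using x by (intro span_diff span_scale e_in_span)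
    fix y assume "y \<in> range e"
    then obtain m where m: "y = e m" by blast
    have "inn (e n) (e n) \<noteq> 0"
      using ip_definite e_nonzero by blast
    then show "inn y (x - sc c (e n)) = 0"
      using orth[of m] inn_e_neq[of m n] m
      by (cases "m = n") (simp_all add: ip_diff_right ip_scale_right c_def)
  qed
  then show ?thesis by auto
qed

text \<open>The core of irreducibility. Lowering a nonzero \<open>x\<close> as often as possible
  gives \<open>y \<noteq> 0\<close> in \<open>W\<close> with \<open>Lm y = 0\<close>. By adjointness
  \<open>y\<close> is orthogonal to every \<open>e (Suc k) = Lp (e k)\<close>, which leaves only a
  multiple of \<open>v\<close>.\<close>

lemma invariant_contains_v:
  assumes W: "invariant_subspace R W" "W \<subseteq> span (range e)" "W \<noteq> {0}"
  shows "v \<in> W"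
proof -
  have sub: "subspace W" and LmW: "x \<in> W \<Longrightarrow> Lm x \<in> W" for x
    using W(1) unfolding invariant_subspace_def by auto
  obtain x where x: "x \<in> W" "x \<noteq> 0"
    using W(3) subspace_0[OF sub] by auto
  define N where "N = (LEAST N. (Lm ^^ N) x = 0)"
  have "\<exists>N. (Lm ^^ N) x = 0"
    using Lm_nilpotent x W(2) by (meson order_refl subsetD)
  then have N: "(Lm ^^ N) x = 0" "\<And>k. k < N \<Longrightarrow> (Lm ^^ k) x \<noteq> 0"
    unfolding N_def by (auto intro: LeastI_ex dest: not_less_Least)
  have "N \<noteq> 0"
    using N(1) x(2) by (metis funpow_0)
  then obtain M where M: "N = Suc M"
    using not0_implies_Suc by blast
  define y where "y = (Lm ^^ M) x"
  have y: "y \<noteq> 0" "Lm y = 0"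
    using N M by (auto simp: y_def)
  have "(Lm ^^ k) x \<in> W" for k
    by (induction k) (simp_all add: x LmW)
  then have yW: "y \<in> W" by (simp add: y_def)
  have "inn (e m) y = 0" if "m \<noteq> 0" for m
  proof -
    obtain k where "m = Suc k" using not0_implies_Suc \<open>m \<noteq> 0\<close> by blast
    then show ?thesis
      using adj(2)[OF e_in, of y k] y yW W(2) span_e_sub by (auto simp: e_Suc)
  qed
  then obtain c where c: "y = sc c (e 0)"
    using eq_multiple_of_e yW W(2) by blast
  with y have "c \<noteq> 0" by auto
  then have "v = sc (inverse c) y"
    by (simp add: c)
  then show ?thesis
    using subspace_scale[OF sub yW] by simp
qed

text \<open>Symmetry of \<open>L0\<close> lets the overlap of \<open>x\<close> with
  \<open>e n\<close> be nonzero only if \<open>z = lam + n\<close>, which happens for at most one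
  \<open>n\<close>.\<close>

lemma eigenspace_e:
  assumes "x \<in> span (range e)" "L0 x = sc z x" "x \<noteq> 0"
  shows "\<exists>n c. z = of_real (lam + real n) \<and> x = sc c (e n)"
proof -
  have *: "of_real (lam + real n) * inn (e n) x = z * inn (e n) x" for n
  proof -
    have "inn (L0 (e n)) x = inn (e n) (L0 x)"
      using assms(1) span_e_sub by (intro adj e_in) auto
    then show ?thesis
      unfolding L0_e assms(2) by (simp add: ip_scale_left ip_scale_right)
  qed
  obtain n where n: "inn (e n) x \<noteq> 0"
    using orthogonal_to_span[OF assms(1)] assms(3) by auto
  with * have z: "z = of_real (lam + real n)" by (metis mult_right_cancel)
  have "inn (e m) x = 0" if "m \<noteq> n" for m
  proof (rule ccontr)
    assume "inn (e m) x \<noteq> 0"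
    with *[of m] have "z = of_real (lam + real m)" by (metis mult_right_cancel)
    with z that show False by (metis add_left_cancel of_nat_eq_iff of_real_eq_iff)
  qed
  then show ?thesis
    using eq_multiple_of_e[OF assms(1)] z by blast
qed

lemma e_inj: "inj e"
  by (metis e_nonzero inn_e_neq ip_definite injI)

text \<open>Needed to prescribe a linear map by its values on the orbit.\<close>

lemma e_independent: "independent (range e)"
  unfolding dependent_def
proof
  assume "\<exists>a\<in>range e. a \<in> span (range e - {a})"
  then obtain n where n: "e n \<in> span (range e - {e n})" by blast
  have "e n = 0"
    by (rule orthogonal_to_span[OF n]) (metis DiffE imageE inn_e_neq singletonI)
  then show False using e_nonzero by blast
qed

lemma discrete_series_generated: "discrete_series_plus lam (generated_rep R v)"
proof -
  let ?G = "R\<lparr>rep_space := span (range e)\<rparr>"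
  have inv: "invariant_subspace ?G W \<longleftrightarrow> invariant_subspace R W" for W
    by (simp add: invariant_subspace_def)
  have uni: "unitary_sl2_rep ?G"
    using unitary invariant_span_e span_e_sub
    unfolding unitary_sl2_rep_def inv linear_map_on_def by (auto simp: subset_iff)
  have irr: "irreducible_sl2_rep ?G"
    unfolding irreducible_sl2_rep_def inv
  proof (intro conjI allI impI)
    show "rep_space ?G \<noteq> {0}"
      using v_props v_in_span by auto
    fix W assume "invariant_subspace R W \<and> W \<subseteq> rep_space ?G"
    then show "W = {0} \<or> W = rep_space ?G"
      using invariant_contains_v[of W] span_e_least[of W] by auto
  qed
  have eig: "L0_eigenspace ?G (of_real (lam + real n)) = span {e n}" for n
  proof
    show "L0_eigenspace ?G (of_real (lam + real n)) \<subseteq> span {e n}"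
    proof
      fix x assume x: "x \<in> L0_eigenspace ?G (of_real (lam + real n))"
      show "x \<in> span {e n}"
      proof (cases "x = 0")
        case False
        then obtain m c where "(of_real (lam + real n) :: complex) = of_real (lam + real m)"
            "x = sc c (e m)"
          using eigenspace_e[of x "of_real (lam + real n)"] x unfolding L0_eigenspace_def by auto
        moreover from this(1) have "m = n" by (metis add_left_cancel of_nat_eq_iff of_real_eq_iff)
        ultimately show ?thesis
          by (auto intro: span_scale span_base)
      qed (simp add: span_zero)
    qed
    have "sc c (e n) \<in> L0_eigenspace ?G (of_real (lam + real n))" for c
      unfolding L0_eigenspace_def
      by (auto simp: ops_scale e_in L0_e mult.commute intro!: span_scale e_in_span)
    then show "span {e n} \<subseteq> L0_eigenspace ?G (of_real (lam + real n))"
      by (auto simp: span_singleton)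
  qed
  have vals: "L0_eigenvalues ?G = {of_real (lam + real n) | n. True}"
  proof
    show "L0_eigenvalues ?G \<subseteq> {of_real (lam + real n) | n. True}"
      using eigenspace_e by (auto simp: L0_eigenvalues_def L0_eigenspace_def)
    have "e n \<in> span {e n}" for n
      by (intro span_base) simp
    then show "{of_real (lam + real n) | n. True} \<subseteq> L0_eigenvalues ?G"
      using eig e_nonzero unfolding L0_eigenvalues_def by blast
  qed
  have dim: "dim (span {e n}) = 1" for n
    using e_nonzero[of n] dim_eq_card_independent[of "{e n}"] by (simp add: dim_span)
  have Lm0: "Lm x = 0" if "x \<in> span {e 0}" for x
    using that by (auto simp: span_singleton ops_scale v_props)
  have "\<forall>z\<in>L0_eigenvalues ?G. dim (L0_eigenspace ?G z) = 1"
    unfolding vals using eig dim by auto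
  moreover have "\<forall>x\<in>L0_eigenspace ?G (of_real lam). Lm x = 0"
    using eig[of 0] Lm0 by simp
  ultimately show ?thesis
    unfolding generated_eq discrete_series_plus_def using lam_pos uni irr vals by simp
qed

lemma lowest_weight_generated: "lowest_weight_vector (generated_rep R v) lam v"
  using v_props v_in_span
  unfolding generated_eq lowest_weight_vector_def L0_eigenspace_def by auto

end

section \<open>Uniqueness of the discrete series\<close>

text \<open>Irreducibility forces the orbit of a lowest-weight vector to span all of
  \<open>rep_space D\<close>. Scaling it to norm one prepares the isometric match with another unit
  lowest-weight vector.\<close>

lemma discrete_series_unit_lowest_weight:
  assumes "discrete_series_plus lam D"
  obtains w where "lowest_weight_rep D lam w" "rep_ip D w w = 1"
    "rep_space D = module.span (rep_scale D) (range (lowest_weight_rep.e D w))"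
proof -
  have uni: "unitary_sl2_rep D" and irr: "irreducible_sl2_rep D" and lam: "0 < lam"
    and vals: "L0_eigenvalues D = {of_real (lam + real n) | n. True}"
    and Lm0: "\<forall>v\<in>L0_eigenspace D (of_real lam). rep_Lm D v = 0"
    using assms unfolding discrete_series_plus_def by blast+
  interpret complex_inner_space "rep_scale D" "rep_ip D"
    using uni unfolding unitary_sl2_rep_def by blast
  have "of_real (lam + real 0) \<in> L0_eigenvalues D"
    unfolding vals by blast
  then obtain w0 where w0: "w0 \<in> L0_eigenspace D (of_real lam)" "w0 \<noteq> 0"
    unfolding L0_eigenvalues_def by auto
  define r where "r = 1 / sqrt (Re (rep_ip D w0 w0))"
  have pos: "Re (rep_ip D w0 w0) > 0"
    using ip_self_pos w0 by blast
  then have r: "r \<noteq> 0" "r * r * Re (rep_ip D w0 w0) = 1"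
    by (auto simp: r_def)
  define w where "w = rep_scale D (of_real r) w0"
  have w_eig: "w \<in> L0_eigenspace D (of_real lam)"
    using uni w0(1) unfolding w_def unitary_sl2_rep_def L0_eigenspace_def invariant_subspace_def
      linear_map_on_def by (auto simp: mult.commute intro: subspace_scale)
  have "w \<noteq> 0"
    using w0 r by (simp add: w_def)
  have "rep_ip D w w = of_real (r * r * Re (rep_ip D w0 w0))"
    unfolding w_def by (simp add: ip_scale_left ip_scale_right) (metis ip_self_real)
  then have unit: "rep_ip D w w = 1"
    using r by simp
  interpret w: lowest_weight_rep D lam w
    by unfold_locales
      (use uni lam w_eig Lm0 \<open>w \<noteq> 0\<close> in \<open>auto simp: lowest_weight_vector_def\<close>)
  have "rep_space D = span (range w.e)"
    using irr w.invariant_span_e w.span_e_sub w.v_props w.v_in_span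
    unfolding irreducible_sl2_rep_def by blast
  then show thesis
    using that w.lowest_weight_rep_axioms unit by blast
qed

text \<open>Matching the orbits \<open>L\<^sub>+\<^sup>n v\<close> of the two lowest-weight vectors is isometric because the
  commutation relations alone determine their norms.\<close>

lemma discrete_series_unique:
  assumes "lowest_weight_rep R lam v" "rep_ip R v v = 1"
    and "discrete_series_plus lam D"
  shows "\<exists>U. unitary_equivalence (generated_rep R v) D U \<and> lowest_weight_vector D lam (U v)"
proof -
  interpret R: lowest_weight_rep R lam v by fact
  obtain w where lw: "lowest_weight_rep D lam w" and unit: "rep_ip D w w = 1"
    and spc: "rep_space D = module.span (rep_scale D) (range (lowest_weight_rep.e D w))"
    using discrete_series_unit_lowest_weight[OF assms(3)] by blast
  interpret D: lowest_weight_rep D lam w by fact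
  interpret P: vector_space_pair "rep_scale R" "rep_scale D" ..
  \<comment> \<open>\<open>construct\<close> gives a map that is linear on the whole ambient space,
    so additivity needs no membership conditions; only its restriction to the span of the orbit
    matters.\<close>
  define U where "U = P.construct (range R.e) (\<lambda>x. D.e (inv R.e x))"
  have linU: "Vector_Spaces.linear (rep_scale R) (rep_scale D) U"
    unfolding U_def by (rule P.linear_construct[OF R.e_independent])
  interpret U: Vector_Spaces.linear "rep_scale R" "rep_scale D" U by fact
  have Ue: "U (R.e n) = D.e n" for n
    unfolding U_def using P.construct_basis[OF R.e_independent, of "R.e n"]
    by (simp add: inv_f_f[OF R.e_inj])
  let ?E = "R.span (range R.e)"
  have imgU: "U ` ?E = rep_space D"
    unfolding spc P.linear_span_image[OF linU, symmetric] image_image Ue ..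
  have U_V: "U x \<in> rep_space D" if "x \<in> ?E" for x
    using that imgU by blast
  have ip_e: "rep_ip D (U (R.e m)) (U (R.e n)) = rep_ip R (R.e m) (R.e n)" for m n
    by (cases "m = n") (simp_all add: Ue R.norm_e D.norm_e assms(2) unit R.inn_e_neq D.inn_e_neq)
  have ip_1: "rep_ip D (U (R.e m)) (U y) = rep_ip R (R.e m) y" if "y \<in> ?E" for m y
    using that
  proof (induction rule: R.span_induct_mem)
    case (step c x y)
    then show ?case
      using ip_e by (auto simp: U.add U.scale R.ip_add_right R.ip_scale_right
          D.ip_add_right D.ip_scale_right)
  qed (simp add: U.zero)
  have ip_U: "rep_ip D (U x) (U y) = rep_ip R x y" if "x \<in> ?E" "y \<in> ?E" for x y
    using that(1)
  proof (induction rule: R.span_induct_mem)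
    case (step c x z)
    then show ?case
      using ip_1[OF that(2)] by (auto simp: U.add U.scale R.ip_add_left R.ip_scale_left
          D.ip_add_left D.ip_scale_left)
  qed (simp add: U.zero)
  have "inj_on U ?E"
  proof (rule inj_onI)
    fix x y assume xy: "x \<in> ?E" "y \<in> ?E" "U x = U y"
    then have "rep_ip R (x - y) (x - y) = 0"
      using ip_U[of "x - y" "x - y"] by (simp add: R.span_diff U.diff)
    then show "x = y"
      using R.ip_definite by fastforce
  qed
  have int_e: "U (rep_L0 R (R.e n)) = rep_L0 D (U (R.e n))"
    "U (rep_Lp R (R.e n)) = rep_Lp D (U (R.e n))"
    "U (rep_Lm R (R.e n)) = rep_Lm D (U (R.e n))" for n
  proof -
    show "U (rep_L0 R (R.e n)) = rep_L0 D (U (R.e n))"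
      by (simp only: R.L0_e D.L0_e Ue U.scale)
    show "U (rep_Lp R (R.e n)) = rep_Lp D (U (R.e n))"
      by (simp only: R.e_Suc[symmetric] D.e_Suc[symmetric] Ue)
    show "U (rep_Lm R (R.e n)) = rep_Lm D (U (R.e n))"
    proof (cases n)
      case 0
      then show ?thesis
        using Ue[of 0] by (simp add: R.v_props D.v_props U.zero)
    next
      case (Suc m)
      then show ?thesis
        by (simp only: R.Lm_e_Suc D.Lm_e_Suc Ue U.scale)
    qed
  qed
  have "U (rep_L0 R x) = rep_L0 D (U x) \<and> U (rep_Lp R x) = rep_Lp D (U x) \<and>
      U (rep_Lm R x) = rep_Lm D (U x)" if "x \<in> ?E" for x
    using that
  proof (induction rule: R.span_induct_mem)
    case (step c x y)
    then obtain n where "x = R.e n" by blast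
    moreover have "y \<in> rep_space R" using step R.span_e_sub by blast
    ultimately show ?case
      using step int_e[of n] R.e_in D.e_in U_V[of y]
      by (simp add: R.ops_add R.ops_scale R.subspace_scale[OF R.subspace_V]
          D.ops_add D.ops_scale D.subspace_scale[OF D.subspace_V] U.add U.scale Ue)
  qed (simp add: U.zero)
  then have "unitary_equivalence (generated_rep R v) D U"
    unfolding unitary_equivalence_def R.generated_eq
    using \<open>inj_on U ?E\<close> imgU ip_U
    by (auto simp: bij_betw_def linear_map_on_def U.add U.scale)
  moreover have "U v = w"
    using Ue[of 0] by simp
  ultimately show ?thesis
    using D.lowest by auto
qed

section \<open>Matrix elements between the modes\<close>

definition dirac_phase :: "real \<Rightarrow> real \<Rightarrow> real \<Rightarrow> real" where
  "dirac_phase \<beta>m \<omega> \<rho> = \<omega> * (\<rho> + pi / 2) + \<beta>m"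

text \<open>The phase equals \<beta>m at the left end, so the boundary condition there holds for
  every \<omega>.\<close>

definition dirac_wave :: "real \<Rightarrow> real \<Rightarrow> real \<Rightarrow> complex^2" where
  "dirac_wave \<beta>m \<omega> \<rho> =
     vector [of_real (sin (dirac_phase \<beta>m \<omega> \<rho>)), of_real (cos (dirac_phase \<beta>m \<omega> \<rho>))]"

lemma vector_2_eqI: "x $ 1 = y $ 1 \<Longrightarrow> x $ 2 = y $ 2 \<Longrightarrow> x = (y :: 'a^2)"
  by (simp add: vec_eq_iff forall_2)

lemma bounded_linear_vector_scalar_mult_right:
  "bounded_linear (\<lambda>x. (c::complex) *s (x :: complex^'n))"
  by (intro linear_conv_bounded_linear[THEN iffD1] linearI)
    (simp_all add: vec_eq_iff algebra_simps)

lemma bounded_linear_vector_scalar_mult_left: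
  "bounded_linear (\<lambda>c::complex. c *s (x :: complex^'n))"
  by (intro linear_conv_bounded_linear[THEN iffD1] linearI)
    (simp_all add: vec_eq_iff algebra_simps)

lemma dirac_eigenfunction_derivative:
  assumes "dirac_eigenfunction \<beta>p \<beta>m \<omega> \<Phi>" "\<rho> \<in> strip"
  shows "(\<Phi> has_vector_derivative d_rho \<Phi> \<rho>) (at \<rho> within strip)"
    and "d_rho \<Phi> \<rho> $ 1 = of_real \<omega> * \<Phi> \<rho> $ 2" "d_rho \<Phi> \<rho> $ 2 = - of_real \<omega> * \<Phi> \<rho> $ 1"
proof -
  show "(\<Phi> has_vector_derivative d_rho \<Phi> \<rho>) (at \<rho> within strip)"
    using assms unfolding dirac_eigenfunction_def d_rho_def
    by (simp add: vector_derivative_works)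
  have *: "dirac_op \<Phi> \<rho> = of_real \<omega> *s \<Phi> \<rho>"
    using assms unfolding dirac_eigenfunction_def by blast
  show "d_rho \<Phi> \<rho> $ 1 = of_real \<omega> * \<Phi> \<rho> $ 2"
    using arg_cong[OF *, of "\<lambda>x. x $ 2"] by (simp add: dirac_op_def)
  show "d_rho \<Phi> \<rho> $ 2 = - of_real \<omega> * \<Phi> \<rho> $ 1"
    using arg_cong[OF *, of "\<lambda>x. x $ 1"]
    by (simp add: dirac_op_def minus_equation_iff eq_commute)
qed

text \<open>\<open>S\<close> and \<open>T\<close> are the components of \<Phi> in a frame rotating
  with the phase \<open>x\<close>, where the eigenvalue equation reads \<open>S' = T' = 0\<close>.
  The boundary condition at the left end is \<open>T = 0\<close>, so the constant value of
  \<open>S\<close> is all that remains.\<close>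

lemma dirac_eigenfunction_form:
  assumes "dirac_eigenfunction \<beta>p \<beta>m \<omega> \<Phi>"
  obtains C where "\<And>\<rho>. \<rho> \<in> strip \<Longrightarrow> \<Phi> \<rho> = C *s dirac_wave \<beta>m \<omega> \<rho>"
proof -
  define x where "x = dirac_phase \<beta>m \<omega>"
  have x: "(x has_real_derivative \<omega>) (at \<rho> within A)" for \<rho> A
  proof -
    have x_eq: "x = (\<lambda>\<rho>. \<omega> * (\<rho> + pi / 2) + \<beta>m)"
      by (simp add: x_def dirac_phase_def fun_eq_iff)
    show ?thesis
      unfolding x_eq by (auto intro!: derivative_eq_intros)
  qed
  define S T where "S \<rho> = \<Phi> \<rho> $ 1 * of_real (sin (x \<rho>)) + \<Phi> \<rho> $ 2 * of_real (cos (x \<rho>))"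
    and "T \<rho> = \<Phi> \<rho> $ 1 * of_real (cos (x \<rho>)) - \<Phi> \<rho> $ 2 * of_real (sin (x \<rho>))" for \<rho>
  have S': "(S has_vector_derivative 0) (at \<rho> within strip)"
    and T': "(T has_vector_derivative 0) (at \<rho> within strip)" if "\<rho> \<in> strip" for \<rho>
  proof -
    note d = dirac_eigenfunction_derivative[OF assms that]
    have comp: "((\<lambda>\<rho>. \<Phi> \<rho> $ i) has_vector_derivative d_rho \<Phi> \<rho> $ i) (at \<rho> within strip)" for i
      by (rule bounded_linear.has_vector_derivative[OF bounded_linear_vec_nth d(1)])
    have sin_d: "((\<lambda>\<rho>. of_real (sin (x \<rho>)) :: complex) has_vector_derivative
        of_real (\<omega> * cos (x \<rho>))) (at \<rho> within strip)"
      by (rule has_vector_derivative_of_real) (auto intro!: derivative_eq_intros x)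
    have cos_d: "((\<lambda>\<rho>. of_real (cos (x \<rho>)) :: complex) has_vector_derivative
        of_real (- \<omega> * sin (x \<rho>))) (at \<rho> within strip)"
      by (rule has_vector_derivative_of_real) (auto intro!: derivative_eq_intros x)
    show "(S has_vector_derivative 0) (at \<rho> within strip)"
      using has_vector_derivative_add[OF has_vector_derivative_mult[OF comp[of 1] sin_d]
          has_vector_derivative_mult[OF comp[of 2] cos_d]]
      unfolding S_def by (simp add: d algebra_simps)
    show "(T has_vector_derivative 0) (at \<rho> within strip)"
      using has_vector_derivative_diff[OF has_vector_derivative_mult[OF comp[of 1] cos_d]
          has_vector_derivative_mult[OF comp[of 2] sin_d]]
      unfolding T_def by (simp add: d algebra_simps)
  qed
  obtain C where C: "\<And>\<rho>. \<rho> \<in> strip \<Longrightarrow> S \<rho> = C"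
    using has_vector_derivative_zero_constant[OF convex_real_interval(5) S'] by metis
  obtain c where c: "\<And>\<rho>. \<rho> \<in> strip \<Longrightarrow> T \<rho> = c"
    using has_vector_derivative_zero_constant[OF convex_real_interval(5) T'] by metis
  have "x (- pi / 2) = \<beta>m"
    by (simp add: x_def dirac_phase_def)
  moreover have "of_real (cos \<beta>m) * \<Phi> (- pi / 2) $ 1 = of_real (sin \<beta>m) * \<Phi> (- pi / 2) $ 2"
    using assms unfolding dirac_eigenfunction_def dirac_bc_def by blast
  ultimately have "T (- pi / 2) = 0"
    by (simp add: T_def mult.commute)
  then have c0: "c = 0"
    using c[of "- pi / 2"] by simp
  have "\<Phi> \<rho> = C *s dirac_wave \<beta>m \<omega> \<rho>" if "\<rho> \<in> strip" for \<rho>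
  proof (rule vector_2_eqI)
    let ?s = "of_real (sin (x \<rho>)) :: complex" and ?c = "of_real (cos (x \<rho>)) :: complex"
    have sc: "?s * ?s + ?c * ?c = 1"
      by (metis of_real_1 of_real_add of_real_mult power2_eq_square sin_cos_squared_add)
    have "\<Phi> \<rho> $ 1 * (?s * ?s + ?c * ?c) = S \<rho> * ?s + T \<rho> * ?c"
      "\<Phi> \<rho> $ 2 * (?s * ?s + ?c * ?c) = S \<rho> * ?c - T \<rho> * ?s"
      by (simp_all add: S_def T_def algebra_simps)
    then have *: "\<Phi> \<rho> $ 1 = S \<rho> * ?s + T \<rho> * ?c" "\<Phi> \<rho> $ 2 = S \<rho> * ?c - T \<rho> * ?s"
      unfolding sc by simp_all
    show "\<Phi> \<rho> $ 1 = (C *s dirac_wave \<beta>m \<omega> \<rho>) $ 1" "\<Phi> \<rho> $ 2 = (C *s dirac_wave \<beta>m \<omega> \<rho>) $ 2"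
      using * C[OF that] c[OF that] c0 by (simp_all add: dirac_wave_def x_def)
  qed
  then show thesis using that by blast
qed

lemma dirac_phase_shift:
  "dirac_phase \<beta>m (\<omega> + s) \<rho> = dirac_phase \<beta>m \<omega> \<rho> + s * \<rho> + s * (pi / 2)"
  by (simp add: dirac_phase_def algebra_simps)

text \<open>The two derivative terms produce the \<open>\<omega>\<close> and the two zeroth-order
  terms the \<open>s / 2\<close>, each multiplying the same addition formula in
  \<open>x + s * \<rho>\<close>. The quarter turn \<open>s * (pi / 2)\<close> in the shifted phase
  identifies the result with the wave of frequency \<open>\<omega> + s\<close>.\<close>

lemma L_shift_mode:
  assumes \<Phi>: "dirac_eigenfunction \<beta>p \<beta>m \<omega> \<Phi>" and \<rho>: "\<rho> \<in> strip" and s: "s = 1 \<or> s = - 1"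
    and C: "\<Phi> \<rho> = C *s dirac_wave \<beta>m \<omega> \<rho>"
  shows "L_shift s (mode \<omega> \<Phi>) t \<rho> =
    (\<i> * of_real (\<omega> + s / 2) * C) *s (exp (- \<i> * of_real ((\<omega> + s) * t)) *s dirac_wave \<beta>m (\<omega> + s) \<rho>)"
proof -
  note d = dirac_eigenfunction_derivative[OF \<Phi> \<rho>]
  define x where "x = dirac_phase \<beta>m \<omega> \<rho>"
  have "(mode \<omega> \<Phi> t has_vector_derivative exp (- \<i> * of_real (\<omega> * t)) *s d_rho \<Phi> \<rho>) (at \<rho> within strip)"
    unfolding mode_def
    by (rule bounded_linear.has_vector_derivative[OF bounded_linear_vector_scalar_mult_right d(1)])
  then have d_rho_mode: "d_rho (mode \<omega> \<Phi> t) \<rho> = exp (- \<i> * of_real (\<omega> * t)) *s d_rho \<Phi> \<rho>"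
    unfolding d_rho_def[of "mode \<omega> \<Phi> t"] using \<rho>
    by (intro vector_derivative_within_closed_interval) auto
  have "((\<lambda>\<tau>. exp (- \<i> * of_real (\<omega> * \<tau>))) has_vector_derivative
      - \<i> * of_real \<omega> * exp (- \<i> * of_real (\<omega> * t))) (at t)"
  proof -
    have "((\<lambda>z. exp (- \<i> * of_real \<omega> * z)) has_field_derivative
        - \<i> * of_real \<omega> * exp (- \<i> * of_real \<omega> * of_real t)) (at (of_real t))"
      by (auto intro!: derivative_eq_intros)
    from has_vector_derivative_real_field[OF this] show ?thesis
      by (simp add: mult.assoc)
  qed
  from bounded_linear.has_vector_derivative[OF bounded_linear_vector_scalar_mult_left this, of "\<Phi> \<rho>"]
  have dt: "vector_derivative (\<lambda>\<tau>. mode \<omega> \<Phi> \<tau> \<rho>) (at t) =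
      (- \<i> * of_real \<omega> * exp (- \<i> * of_real (\<omega> * t))) *s \<Phi> \<rho>"
    unfolding mode_def by (rule vector_derivative_at)
  have exp_shift: "exp (- \<i> * of_real ((\<omega> + s) * t)) =
      exp (- \<i> * of_real (s * t)) * exp (- \<i> * of_real (\<omega> * t))"
    by (simp add: exp_add[symmetric] algebra_simps)
  have c1: "\<Phi> \<rho> $ 1 = C * of_real (sin x)" and c2: "\<Phi> \<rho> $ 2 = C * of_real (cos x)"
    by (simp_all add: C dirac_wave_def x_def)
  define W where "W = dirac_wave \<beta>m (\<omega> + s) \<rho>"
  have w: "W $ 1 = of_real (s * cos (x + s * \<rho>))" "W $ 2 = of_real (- s * sin (x + s * \<rho>))"
    using s by (auto simp: W_def dirac_wave_def dirac_phase_shift x_def sin_add cos_add)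
  have S: "Sigma01 *v y = vector [\<i> / 2 * y $ 2, - \<i> / 2 * y $ 1]" for y
    by (rule vector_2_eqI) (simp_all add: Sigma01_def matrix_vector_mult_def sum_2)
  define E F where "E = exp (- \<i> * of_real (s * t))" and "F = exp (- \<i> * of_real (\<omega> * t))"
  have "L_shift s (mode \<omega> \<Phi>) t \<rho> = E *s
     ((\<i> * of_real (s * cos \<rho>)) *s (F *s d_rho \<Phi> \<rho>) - (\<i> / 2 * of_real (s * sin \<rho>)) *s (F *s \<Phi> \<rho>)
      + of_real (sin \<rho>) *s ((- \<i> * of_real \<omega> * F) *s \<Phi> \<rho>)
      + of_real (cos \<rho>) *s vector [\<i> / 2 * (F * \<Phi> \<rho> $ 2), - \<i> / 2 * (F * \<Phi> \<rho> $ 1)])"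
    unfolding L_shift_def d_rho_mode dt by (simp add: S mode_def E_def F_def)
  also have "\<dots> = (\<i> * of_real (\<omega> + s / 2) * C) *s ((E * F) *s W)"
    using s
  proof
    assume [simp]: "s = 1"
    show ?thesis
      by (rule vector_2_eqI) (simp_all add: d c1 c2 w cos_add sin_add algebra_simps)
  next
    assume [simp]: "s = - 1"
    show ?thesis
      by (rule vector_2_eqI) (simp_all add: d c1 c2 w cos_diff sin_diff algebra_simps)
  qed
  finally show ?thesis
    unfolding exp_shift E_def F_def W_def .
qed

section \<open>Orthogonality and matrix elements\<close>

lemma integral_cos_strip:
  "integral strip (\<lambda>\<rho>. cos (of_int m * (\<rho> + pi / 2))) = (if m = 0 then pi else 0)"
proof (cases "m = 0")
  case False
  have "((\<lambda>\<rho>. cos (of_int m * (\<rho> + pi / 2))) has_integral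
      (sin (of_int m * (pi / 2 + pi / 2)) / of_int m -
       sin (of_int m * (- pi / 2 + pi / 2)) / of_int m)) strip"
    by (rule fundamental_theorem_of_calculus)
      (use False in \<open>auto intro!: derivative_eq_intros
        simp: has_real_derivative_iff_has_vector_derivative[symmetric]\<close>)
  moreover have "sin (of_int m * (pi / 2 + pi / 2)) = 0"
    by (metis field_sum_of_halves mult.commute sin_integer_2pi sin_zero_iff_int2)
  ultimately show ?thesis
    using False by (simp add: integral_unique)
qed simp

text \<open>The pointwise product of two waves is the cosine of their phase difference, from which
  \<beta>m and the common frequency drop out; its integral over a strip of length \<open>pi\<close>
  vanishes for \<open>m \<noteq> 0\<close>. The time-dependent factor \<open>K\<close> is one when
  \<open>m = 0\<close>.\<close>

lemma spinor_ip_modes: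
  assumes \<Phi>: "\<And>\<rho>. \<rho> \<in> strip \<Longrightarrow> \<Phi> \<rho> = C *s dirac_wave \<beta>m \<omega> \<rho>"
    and \<Phi>': "\<And>\<rho>. \<rho> \<in> strip \<Longrightarrow> \<Phi>' \<rho> = C' *s dirac_wave \<beta>m \<omega>' \<rho>"
    and m: "\<omega>' = \<omega> + of_int m"
  shows "spinor_ip t (mode \<omega> \<Phi>) (mode \<omega>' \<Phi>') = (if m = 0 then cnj C * C' * of_real pi else 0)"
proof -
  define K where "K = cnj (exp (- \<i> * of_real (\<omega> * t))) * exp (- \<i> * of_real (\<omega>' * t))"
  have "(\<Sum>i\<in>UNIV. cnj (mode \<omega> \<Phi> t \<rho> $ i) * mode \<omega>' \<Phi>' t \<rho> $ i) =
      (cnj C * C' * K) * of_real (cos (of_int m * (\<rho> + pi / 2)))" if "\<rho> \<in> strip" for \<rho>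
  proof -
    have "of_int m * (\<rho> + pi / 2) = dirac_phase \<beta>m \<omega>' \<rho> - dirac_phase \<beta>m \<omega> \<rho>"
      by (simp add: m dirac_phase_def algebra_simps)
    then show ?thesis
      unfolding K_def
      by (simp only: sum_2 mode_def \<Phi>[OF that] \<Phi>'[OF that] dirac_wave_def cos_diff
          vector_smult_component vector_2 complex_cnj_mult complex_cnj_complex_of_real
          of_real_add of_real_mult distrib_left mult.assoc mult.commute mult.left_commute add.commute)
  qed
  then have "spinor_ip t (mode \<omega> \<Phi>) (mode \<omega>' \<Phi>') =
      integral strip (\<lambda>\<rho>. (cnj C * C' * K) * of_real (cos (of_int m * (\<rho> + pi / 2))))"
    unfolding spinor_ip_def by (intro integral_cong) blast
  also have "\<dots> = (cnj C * C' * K) * of_real (integral strip (\<lambda>\<rho>. cos (of_int m * (\<rho> + pi / 2))))"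
  proof -
    have "(\<lambda>\<rho>. cos (of_int m * (\<rho> + pi / 2))) integrable_on strip"
      by (intro integrable_continuous_real continuous_intros)
    then have "((\<lambda>\<rho>. cos (of_int m * (\<rho> + pi / 2))) has_integral
        integral strip (\<lambda>\<rho>. cos (of_int m * (\<rho> + pi / 2)))) strip"
      by (rule integrable_integral)
    then show ?thesis
      by (intro integral_unique has_integral_mult_right has_integral_of_real)
  qed
  finally have "spinor_ip t (mode \<omega> \<Phi>) (mode \<omega>' \<Phi>') =
      (cnj C * C' * K) * of_real (if m = 0 then pi else 0)"
    unfolding integral_cos_strip .
  moreover have "K = 1" if "m = 0"
    using that by (simp add: K_def m exp_cnj exp_add[symmetric])
  ultimately show ?thesis
    by (cases "m = 0") simp_all
qed

lemma spinor_ip_cong: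
  assumes "\<And>\<rho>. \<rho> \<in> strip \<Longrightarrow> \<Psi>' t \<rho> = c *s \<Psi>'' t \<rho>"
  shows "spinor_ip t \<Psi> \<Psi>' = c * spinor_ip t \<Psi> \<Psi>''"
proof -
  have "spinor_ip t \<Psi> \<Psi>' =
      integral strip (\<lambda>\<rho>. c * (\<Sum>i\<in>UNIV. cnj (\<Psi> t \<rho> $ i) * \<Psi>'' t \<rho> $ i))"
    unfolding spinor_ip_def
    by (intro integral_cong) (simp add: assms del: atLeastAtMost_iff, simp add: sum_2 algebra_simps)
  then show ?thesis
    by (simp add: spinor_ip_def)
qed

text \<open>Normalization fixes only the modulus of each \<open>C k\<close>, so \<open>p k\<close>
  carries an unknown phase \<open>C k / C (k + 1)\<close>; the third property is what is independent
  of it.\<close>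

lemma mode_matrix_elements:
  fixes \<omega> :: "int \<Rightarrow> real"
  assumes \<omega>: "\<And>j. \<omega> j = \<mu> + of_int j"
    and \<Phi>: "\<And>j. dirac_eigenfunction \<beta>p \<beta>m (\<omega> j) (\<Phi> j)"
    and \<Psi>: "\<And>j. \<Psi> j = mode (\<omega> j) (\<Phi> j)"
    and unit: "\<And>j. spinor_ip t (\<Psi> j) (\<Psi> j) = 1"
  obtains p :: "int \<Rightarrow> complex"
  where "\<And>j k. spinor_ip t (\<Psi> j) (L_plus (\<Psi> k)) = (if j = k + 1 then p k else 0)"
    and "\<And>j k. spinor_ip t (\<Psi> j) (L_minus (\<Psi> k)) = (if k = j + 1 then - cnj (p j) else 0)"
    and "\<And>k. p k * cnj (p k) = of_real ((\<omega> k + 1 / 2)\<^sup>2)"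
proof -
  have "\<exists>C. \<forall>\<rho>\<in>strip. \<Phi> j \<rho> = C *s dirac_wave \<beta>m (\<omega> j) \<rho>" for j
    by (rule dirac_eigenfunction_form[OF \<Phi>[of j]]) blast
  then obtain C where C: "\<And>\<rho>. \<rho> \<in> strip \<Longrightarrow> \<Phi> j \<rho> = C j *s dirac_wave \<beta>m (\<omega> j) \<rho>" for j
    by metis
  have ip: "spinor_ip t (\<Psi> j) (\<Psi> k) = (if k = j then cnj (C j) * C k * of_real pi else 0)" for j k
    using spinor_ip_modes[OF C C, of k j "k - j" t] by (simp add: \<omega> \<Psi>)
  have CC: "cnj (C j) * C j * of_real pi = 1" for j
    using ip[of j j] unit[of j] by simp
  then have C0: "C j \<noteq> 0" for j
    using CC[of j] by (metis mult_zero_left mult_zero_right zero_neq_one)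
  have ortho: "spinor_ip t (\<Psi> j) (\<Psi> k) = (if j = k then 1 else 0)" for j k
    using ip[of j k] CC[of j] by auto
  have L: "spinor_ip t (\<Psi> j) (L_shift (of_int s) (\<Psi> k)) =
      (if j = k + s then \<i> * of_real (\<omega> k + of_int s / 2) * C k / C (k + s) else 0)"
    if s: "s = 1 \<or> s = - 1" for j k s
  proof -
    have "L_shift (of_int s) (\<Psi> k) t \<rho> =
        (\<i> * of_real (\<omega> k + of_int s / 2) * C k / C (k + s)) *s \<Psi> (k + s) t \<rho>"
      if "\<rho> \<in> strip" for \<rho>
    proof -
      have "\<omega> (k + s) = \<omega> k + of_int s" by (simp add: \<omega>)
      moreover have "real_of_int s = 1 \<or> real_of_int s = - 1"
        using s by auto
      ultimately show ?thesis
        using L_shift_mode[OF \<Phi>[of k] that _ C[OF that, of k], where s = "of_int s" and t = t]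
          C0[of "k + s"]
        by (simp add: \<Psi> mode_def C[OF that] vector_smult_assoc mult.assoc mult.commute mult.left_commute)
    qed
    then show ?thesis
      by (subst spinor_ip_cong) (auto simp: ortho)
  qed
  define p where "p k = \<i> * of_real (\<omega> k + 1 / 2) * C k / C (k + 1)" for k
  \<comment> \<open>All \<open>C k\<close> have equal modulus, so the ratio is a phase and
    conjugation inverts it. This turns the coefficient of \<open>L_minus\<close> into
    \<open>- cnj (p j)\<close>.\<close>
  have cnj_ratio: "cnj (C k / C (k + 1)) = C (k + 1) / C k" for k
  proof -
    have "cnj (C k) * C k = cnj (C (k + 1)) * C (k + 1)"
      using CC[of k] CC[of "k + 1"] pi_neq_zero by (metis mult_right_cancel of_real_eq_0_iff)
    then show ?thesis
      using C0 by (simp add: field_simps)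
  qed
  show thesis
  proof (rule that[of p])
    show "spinor_ip t (\<Psi> j) (L_plus (\<Psi> k)) = (if j = k + 1 then p k else 0)" for j k
      using L[of 1 j k] by (simp add: p_def)
    show "spinor_ip t (\<Psi> j) (L_minus (\<Psi> k)) = (if k = j + 1 then - cnj (p j) else 0)" for j k
    proof (cases "k = j + 1")
      case True
      have "- cnj (p j) = \<i> * of_real (\<omega> j + 1 / 2) * cnj (C j / C (j + 1))"
        by (simp add: p_def)
      also have "\<dots> = \<i> * of_real (\<omega> k - 1 / 2) * C k / C j"
        unfolding cnj_ratio True by (simp add: \<omega>)
      finally show ?thesis
        using L[of "- 1" j k] True by simp
    qed (use L[of "- 1" j k] in auto)
    show "p k * cnj (p k) = of_real ((\<omega> k + 1 / 2)\<^sup>2)" for k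
    proof -
      define r :: complex where "r = of_real (\<omega> k + 1 / 2)"
      have "p k = \<i> * r * (C k / C (k + 1))"
        by (simp add: p_def r_def)
      moreover from this have "cnj (p k) = - \<i> * r * (C (k + 1) / C k)"
        unfolding cnj_ratio[symmetric] by (simp add: r_def)
      ultimately have "p k * cnj (p k) = (- (\<i> * \<i>) * r * r) * ((C k / C (k + 1)) * (C (k + 1) / C k))"
        by (simp only: mult.assoc mult.commute mult.left_commute mult_minus_left mult_minus_right)
      then show ?thesis
        using C0[of k] C0[of "k + 1"] by (simp add: r_def power2_eq_square)
    qed
  qed
qed

section \<open>Charges on Fock space\<close>

context fermionic_fock
begin

section \<open>Anticommutation relations and bilinears\<close>

abbreviation "c \<equiv> field_coeff a bdag"
abbreviation "cd \<equiv> field_coeff adag b"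

lemma linear_c: "Vector_Spaces.linear smul smul (c k)"
  and linear_cd: "Vector_Spaces.linear smul smul (cd k)"
  using linear_ops by (simp_all add: field_coeff_def)

lemmas linear_hom = Vector_Spaces.linear.axioms(3)

lemmas c_simps = linear_c[THEN linear_hom, THEN module_hom.add]
  linear_c[THEN linear_hom, THEN module_hom.diff] linear_c[THEN linear_hom, THEN module_hom.neg]
  linear_c[THEN linear_hom, THEN module_hom.scale] linear_c[THEN linear_hom, THEN module_hom.zero]
  linear_c[THEN linear_hom, THEN module_hom.sum]
lemmas cd_simps = linear_cd[THEN linear_hom, THEN module_hom.add]
  linear_cd[THEN linear_hom, THEN module_hom.diff] linear_cd[THEN linear_hom, THEN module_hom.neg]
  linear_cd[THEN linear_hom, THEN module_hom.scale] linear_cd[THEN linear_hom, THEN module_hom.zero]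
  linear_cd[THEN linear_hom, THEN module_hom.sum]

text \<open>Exchanging \<open>b\<close> and \<open>bdag\<close> at negative indices preserves the
  relations, so all integer modes can be treated alike; only the vacuum distinguishes particles from
  holes.\<close>

lemma car_c_cd: "c j (cd k x) + cd k (c j x) = (if j = k then x else 0)"
  using car_delta car_zero(5-8)
  by (auto simp: field_coeff_def nat_eq_iff add.commute)

lemma car_c_c: "c j (c k x) + c k (c j x) = 0"
  using car_zero by (auto simp: field_coeff_def add.commute)

lemma car_cd_cd: "cd j (cd k x) + cd k (cd j x) = 0"
  using car_zero by (auto simp: field_coeff_def add.commute)

lemma ip_adag: "ip (adag j x) y = ip x (a j y)" and ip_bdag: "ip (bdag j x) y = ip x (b j y)"
  by (metis adjoints ip_hermitian)+

lemma ip_c: "ip (c k x) y = ip x (cd k y)" and ip_cd: "ip (cd k x) y = ip x (c k y)"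
  by (simp_all add: field_coeff_def adjoints ip_adag ip_bdag)

text \<open>The commutation relation of matrix units: the quartic remainders agree, because two sign
  changes cancel. The products are not normal ordered, so no central term arises at this
  stage.\<close>

lemma bilinear_commutator:
  "cd i (c j (cd k (c l x))) - cd k (c l (cd i (c j x))) =
     (if j = k then cd i (c l x) else 0) - (if i = l then cd k (c j x) else 0)"
proof -
  have move: "c j (cd k y) = (if j = k then y else 0) - cd k (c j y)" for j k y
    using car_c_cd[of j k y] by (simp add: eq_diff_eq)
  have anti: "cd i (cd k y) = - cd k (cd i y)" "c j (c l y) = - c l (c j y)" for i j k l y
    using car_cd_cd[of i k y] car_c_c[of j l y] by (simp_all add: eq_neg_iff_add_eq_0)
  have "cd i (cd k (c j (c l x))) = cd k (cd i (c l (c j x)))"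
    by (subst anti(1), subst anti(2)) (simp add: cd_simps)
  then show ?thesis
    unfolding move[of j k] move[of l i] by (simp add: cd_simps)
qed

section \<open>Finite windows of modes\<close>

text \<open>\<open>cd k v = 0\<close> says that mode \<open>k\<close> is filled. Mode
  \<open>- int N\<close> is included so that the hop from \<open>- int N - 1\<close> up into it is
  already blocked.\<close>

definition cutoff :: "nat \<Rightarrow> 'v \<Rightarrow> bool" where
  "cutoff N v \<longleftrightarrow> (\<forall>k. (int N \<le> k \<longrightarrow> c k v = 0) \<and> (k \<le> - int N \<longrightarrow> cd k v = 0))"

lemma cutoff_mono: "cutoff N v \<Longrightarrow> N \<le> M \<Longrightarrow> cutoff M v"
  unfolding cutoff_def by (auto dest!: spec)

lemma linear_ops_simps:
  "a j (x + y) = a j x + a j y" "a j (smul z x) = smul z (a j x)" "a j 0 = 0" "a j (- x) = - a j x"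
  "b j (x + y) = b j x + b j y" "b j (smul z x) = smul z (b j x)" "b j 0 = 0" "b j (- x) = - b j x"
  "adag j 0 = 0" "bdag j 0 = 0"
  using linear_ops[THEN linear_hom, THEN module_hom.add] linear_ops[THEN linear_hom, THEN module_hom.scale]
    linear_ops[THEN linear_hom, THEN module_hom.zero] linear_ops[THEN linear_hom, THEN module_hom.neg]
  by simp_all

text \<open>By cyclicity it is enough that the property passes from \<open>x\<close> to its images
  under the generators. A generator of index \<open>j\<close> anticommutes with \<open>a k\<close>
  and \<open>b k\<close> once \<open>k > j\<close>.\<close>

lemma eventually_annihilated: "\<exists>N. \<forall>k\<ge>N. a k v = 0 \<and> b k v = 0"
proof -
  define W where "W = {v. \<exists>N. \<forall>k\<ge>N. a k v = 0 \<and> b k v = 0}"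
  have adag_W: "adag j x \<in> W" and bdag_W: "bdag j x \<in> W" and a_W: "a j x \<in> W" and b_W: "b j x \<in> W"
    if x: "x \<in> W" for j x
  proof -
    obtain N where N: "\<forall>k\<ge>N. a k x = 0 \<and> b k x = 0"
      using x unfolding W_def by blast
    let ?M = "max N (Suc j)"
    have "a k (a j x) = 0 \<and> b k (a j x) = 0" "a k (b j x) = 0 \<and> b k (b j x) = 0"
      "a k (adag j x) = 0 \<and> b k (adag j x) = 0" "a k (bdag j x) = 0 \<and> b k (bdag j x) = 0"
      if "k \<ge> ?M" for k
    proof -
      have k: "a k x = 0" "b k x = 0" "k \<noteq> j" using N that by auto
      show "a k (a j x) = 0 \<and> b k (a j x) = 0"
        using car_zero(1)[of k j x] car_zero(5)[of j k x] by (simp add: k linear_ops_simps)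
      show "a k (b j x) = 0 \<and> b k (b j x) = 0"
        using car_zero(3)[of k j x] car_zero(5)[of k j x] by (simp add: k linear_ops_simps)
      show "a k (adag j x) = 0 \<and> b k (adag j x) = 0"
        using car_delta(1)[of k j x] car_zero(7)[of j k x] by (simp add: k linear_ops_simps)
      show "a k (bdag j x) = 0 \<and> b k (bdag j x) = 0"
        using car_delta(2)[of k j x] car_zero(6)[of k j x] by (simp add: k linear_ops_simps)
    qed
    then show "adag j x \<in> W" "bdag j x \<in> W" "a j x \<in> W" "b j x \<in> W"
      unfolding W_def by blast+
  qed
  have "W = UNIV"
  proof (rule cyclic)
    show "subspace W"
    proof (rule subspaceI)
      show "0 \<in> W" by (auto simp: W_def linear_ops_simps)
      show "x + y \<in> W" if xy: "x \<in> W" "y \<in> W" for x y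
      proof -
        obtain N M where "\<forall>k\<ge>N. a k x = 0 \<and> b k x = 0" "\<forall>k\<ge>M. a k y = 0 \<and> b k y = 0"
          using xy unfolding W_def by blast
        then have "\<forall>k\<ge>max N M. a k (x + y) = 0 \<and> b k (x + y) = 0"
          by (simp add: linear_ops_simps)
        then show ?thesis unfolding W_def by blast
      qed
      show "smul z x \<in> W" if "x \<in> W" for z x
        using that by (auto simp: W_def linear_ops_simps)
    qed
    show "vac \<in> W"
      by (simp add: W_def vac_annihilated)
  qed (use adag_W bdag_W a_W b_W in blast)
  then show ?thesis unfolding W_def by blast
qed

lemma eventually_cutoff: "\<forall>\<^sub>F N in sequentially. cutoff N v"
proof -
  obtain N where N: "\<And>k. k \<ge> N \<Longrightarrow> a k v = 0 \<and> b k v = 0"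
    using eventually_annihilated by blast
  \<comment> \<open>\<open>Suc N\<close> is due to the shift in \<open>field_coeff\<close>: mode
    \<open>k < 0\<close> has hole index \<open>- k - 1\<close>, which is at least \<open>N\<close>
    only from \<open>k = - int N - 1\<close> downwards.\<close>
  have "cutoff (Suc N) v"
    unfolding cutoff_def field_coeff_def using N by auto
  then show ?thesis
    using cutoff_mono unfolding eventually_sequentially by blast
qed

definition hop :: "int \<Rightarrow> 'v \<Rightarrow> 'v" where
  "hop k v = cd (k + 1) (c k v)"

definition unhop :: "int \<Rightarrow> 'v \<Rightarrow> 'v" where
  "unhop k v = cd k (c (k + 1) v)"

definition occ :: "int \<Rightarrow> 'v \<Rightarrow> 'v" where
  "occ k v = cd k (c k v)"

lemma hop_simps:
  "hop k (x + y) = hop k x + hop k y" "hop k (smul z x) = smul z (hop k x)"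
  "hop k (sum f A) = (\<Sum>i\<in>A. hop k (f i))"
  "unhop k (x + y) = unhop k x + unhop k y" "unhop k (smul z x) = smul z (unhop k x)"
  "unhop k (sum f A) = (\<Sum>i\<in>A. unhop k (f i))"
  "occ k (x + y) = occ k x + occ k y" "occ k (smul z x) = smul z (occ k x)"
  "occ k (sum f A) = (\<Sum>i\<in>A. occ k (f i))"
  by (simp_all add: hop_def unhop_def occ_def c_simps cd_simps)

lemma ip_hop: "ip (hop k x) y = ip x (unhop k y)"
  by (simp add: hop_def unhop_def ip_c ip_cd)

lemma ip_occ: "ip (occ k x) y = ip x (occ k y)"
  by (simp add: occ_def ip_c ip_cd)

text \<open>Above the window the mode to be emptied is already empty. Below it, after one
  anticommutation, the mode to be filled is already full.\<close>

lemma cutoff_outside: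
  assumes "cutoff N v" "k \<notin> {- int N..<int N}"
  shows "hop k v = 0" "unhop k v = 0"
proof -
  have *: "c k v = 0" "c (k + 1) v = 0" if "int N \<le> k"
    using assms(1) that unfolding cutoff_def by auto
  have **: "cd k v = 0" "cd (k + 1) v = 0" if "k < - int N"
    using assms(1) that unfolding cutoff_def by auto
  have "hop k v = - c k (cd (k + 1) v)" "unhop k v = - c (k + 1) (cd k v)"
    using car_c_cd[of k "k + 1" v] car_c_cd[of "k + 1" k v]
    by (simp_all add: hop_def unhop_def eq_neg_iff_add_eq_0 add.commute)
  then show "hop k v = 0" "unhop k v = 0"
    using * ** assms(2) by (cases "int N \<le> k"; simp add: hop_def unhop_def c_simps cd_simps)+
qed

lemma cutoff_occ:
  assumes "cutoff N v"
  shows "occ (int N) v = 0" "occ (- int N) v = v"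
proof -
  have "c (int N) v = 0" "cd (- int N) v = 0"
    using assms unfolding cutoff_def by auto
  then show "occ (int N) v = 0" "occ (- int N) v = v"
    using car_c_cd[of "- int N" "- int N" v] by (simp_all add: occ_def c_simps cd_simps)
qed

lemma hop_unhop_commutator:
  "hop k (unhop l v) - unhop l (hop k v) = (if k = l then occ (k + 1) v - occ k v else 0)"
  unfolding hop_def unhop_def occ_def
  using bilinear_commutator[of "k + 1" k l "l + 1" v] by auto

lemma occ_hop_commutator:
  "occ k (hop l v) - hop l (occ k v) = (if k = l + 1 then hop l v else 0) - (if k = l then hop l v else 0)"
  unfolding hop_def occ_def
  using bilinear_commutator[of k k "l + 1" l v] by auto

text \<open>The matrix elements leave a single off-diagonal and the cutoff a finite piece of it. Any
  admissible \<open>N\<close> gives the same value, so several vectors can be compared on a common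
  window.\<close>

lemma charge_plus_cutoff:
  assumes p: "\<And>j k. spinor_ip t (\<Psi> j) (L (\<Psi> k)) = (if j = k + 1 then p k else 0)"
    and N: "cutoff N v"
  shows "charge smul a adag b bdag t \<Psi> L v = (\<Sum>k\<in>{- int N..<int N}. smul (p k) (hop k v))"
    and "finite {jk. charge_term smul a adag b bdag t \<Psi> L v jk \<noteq> 0}"
proof -
  let ?A = "(\<lambda>k. (k + 1, k)) ` {- int N..<int N}"
  have sub: "{jk. charge_term smul a adag b bdag t \<Psi> L v jk \<noteq> 0} \<subseteq> ?A"
  proof
    fix jk assume jk: "jk \<in> {jk. charge_term smul a adag b bdag t \<Psi> L v jk \<noteq> 0}"
    obtain j k where [simp]: "jk = (j, k)" by fastforce
    have "j = k + 1" and "hop k v \<noteq> 0"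
      using jk by (auto simp: charge_term_def p hop_def split: if_splits)
    then have "k \<in> {- int N..<int N}"
      using cutoff_outside(1)[OF N] by blast
    then show "jk \<in> ?A"
      using \<open>j = k + 1\<close> by (simp add: image_iff)
  qed
  then show "finite {jk. charge_term smul a adag b bdag t \<Psi> L v jk \<noteq> 0}"
    by (rule finite_subset) simp
  have "charge smul a adag b bdag t \<Psi> L v = sum (charge_term smul a adag b bdag t \<Psi> L v) ?A"
    unfolding charge_def by (rule Sum_any.expand_superset[OF _ sub]) simp
  also have "\<dots> = (\<Sum>k\<in>{- int N..<int N}. smul (p k) (hop k v))"
    by (subst sum.reindex) (auto simp: inj_on_def charge_term_def p hop_def intro!: sum.cong)
  finally show "charge smul a adag b bdag t \<Psi> L v = (\<Sum>k\<in>{- int N..<int N}. smul (p k) (hop k v))" .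
qed

lemma charge_minus_cutoff:
  assumes p: "\<And>j k. spinor_ip t (\<Psi> j) (L (\<Psi> k)) = (if k = j + 1 then p j else 0)"
    and N: "cutoff N v"
  shows "charge smul a adag b bdag t \<Psi> L v = (\<Sum>k\<in>{- int N..<int N}. smul (p k) (unhop k v))"
    and "finite {jk. charge_term smul a adag b bdag t \<Psi> L v jk \<noteq> 0}"
proof -
  let ?A = "(\<lambda>k. (k, k + 1)) ` {- int N..<int N}"
  have sub: "{jk. charge_term smul a adag b bdag t \<Psi> L v jk \<noteq> 0} \<subseteq> ?A"
  proof
    fix jk assume jk: "jk \<in> {jk. charge_term smul a adag b bdag t \<Psi> L v jk \<noteq> 0}"
    obtain j k where [simp]: "jk = (j, k)" by fastforce
    have "k = j + 1" and "unhop j v \<noteq> 0"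
      using jk by (auto simp: charge_term_def p unhop_def split: if_splits)
    then have "j \<in> {- int N..<int N}"
      using cutoff_outside(2)[OF N] by blast
    then show "jk \<in> ?A"
      using \<open>k = j + 1\<close> by (simp add: image_iff)
  qed
  then show "finite {jk. charge_term smul a adag b bdag t \<Psi> L v jk \<noteq> 0}"
    by (rule finite_subset) simp
  have "charge smul a adag b bdag t \<Psi> L v = sum (charge_term smul a adag b bdag t \<Psi> L v) ?A"
    unfolding charge_def by (rule Sum_any.expand_superset[OF _ sub]) simp
  also have "\<dots> = (\<Sum>k\<in>{- int N..<int N}. smul (p k) (unhop k v))"
    by (subst sum.reindex) (auto simp: inj_on_def charge_term_def p unhop_def intro!: sum.cong)
  finally show "charge smul a adag b bdag t \<Psi> L v = (\<Sum>k\<in>{- int N..<int N}. smul (p k) (unhop k v))" .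
qed

lemma energy_term_cutoff:
  assumes "cutoff N v"
  shows "{j. energy_term smul a adag b bdag \<omega> v j \<noteq> 0} \<subseteq> {..<N}"
proof -
  have "a j v = 0 \<and> b j v = 0" if "j \<ge> N" for j
    using assms that unfolding cutoff_def field_coeff_def
    by (auto dest: spec[of _ "int j"] spec[of _ "- int j - 1"])
  then show ?thesis
    by (force simp: energy_term_def linear_ops_simps not_less[symmetric])
qed

lemma sum_symmetric_interval_Suc:
  "(\<Sum>k\<in>{- int (Suc N)..<int (Suc N)}. f k) =
     (\<Sum>k\<in>{- int N..<int N}. f k) + f (int N) + (f (- int N - 1) :: 'v)"
proof -
  have "{- int (Suc N)..<int (Suc N)} = insert (int N) (insert (- int N - 1) {- int N..<int N})"
    by auto
  then show ?thesis by (simp add: add_ac)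
qed

end

section \<open>The algebra of the charges\<close>

text \<open>The constant \<open>(\<mu> - N - 1/2)\<^sup>2 / 2\<close> in \<open>L0_cutoff\<close> below is half the squared matrix element of
  \<open>L\<^sub>+\<close> across the lower cutoff; with it the Dirac sea is summed without normal ordering.\<close>

locale fock_charges = fermionic_fock smul ip a adag b bdag vac
  for smul :: "complex \<Rightarrow> 'v::ab_group_add \<Rightarrow> 'v" and ip a adag b bdag vac +
  fixes p :: "int \<Rightarrow> complex" and \<omega> :: "int \<Rightarrow> real" and \<mu> lam :: real and Lp Lm :: "'v \<Rightarrow> 'v"
  assumes \<omega>: "\<And>k. \<omega> k = \<mu> + of_int k"
    and p: "\<And>k. p k * cnj (p k) = of_real ((\<omega> k + 1 / 2)\<^sup>2)"
    and lam: "lam = (\<mu> - 1 / 2)\<^sup>2 / 2"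
    and Lp: "\<And>N v. cutoff N v \<Longrightarrow> Lp v = (\<Sum>k\<in>{- int N..<int N}. smul (p k) (hop k v))"
    and Lm: "\<And>N v. cutoff N v \<Longrightarrow> Lm v = (\<Sum>k\<in>{- int N..<int N}. smul (- cnj (p k)) (unhop k v))"
begin

definition L0 :: "'v \<Rightarrow> 'v" where
  "L0 v = Sum_any (energy_term smul a adag b bdag \<omega> v) + smul (of_real lam) v"

text \<open>Widening the window includes the sea mode \<open>- int N - 1\<close>, whose occupation
  is one minus the number of \<open>b\<close> quanta. Its unit part contributes
  \<open>\<omega> (- int N - 1)\<close>, exactly the amount by which the half square drops; on the
  empty window the half square is \<open>lam\<close>.\<close>

lemma energy_sum:
  "(\<Sum>k\<in>{- int N..<int N}. smul (of_real (\<omega> k)) (occ k v)) +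
     smul (of_real ((\<mu> - real N - 1 / 2)\<^sup>2 / 2)) v =
   (\<Sum>j<N. energy_term smul a adag b bdag \<omega> v j) + smul (of_real lam) v"
proof (induction N)
  case (Suc N)
  have "b N (bdag N v) = v - bdag N (b N v)"
    using car_delta(2)[of N N v] by (simp add: eq_diff_eq)
  then have occ: "occ (- int N - 1) v = v - bdag N (b N v)" "occ (int N) v = adag N (a N v)"
    by (simp_all add: occ_def field_coeff_def)
  have "(\<mu> - real N - 1 / 2)\<^sup>2 / 2 = \<omega> (- int N - 1) + (\<mu> - real (Suc N) - 1 / 2)\<^sup>2 / 2"
    by (simp add: \<omega> power2_eq_square field_simps)
  then have "smul (of_real ((\<mu> - real N - 1 / 2)\<^sup>2 / 2)) v =
      smul (of_real (\<omega> (- int N - 1))) v + smul (of_real ((\<mu> - real (Suc N) - 1 / 2)\<^sup>2 / 2)) v"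
    by (simp only: of_real_add scale_left_distrib)
  then have "(\<Sum>k\<in>{- int (Suc N)..<int (Suc N)}. smul (of_real (\<omega> k)) (occ k v)) +
      smul (of_real ((\<mu> - real (Suc N) - 1 / 2)\<^sup>2 / 2)) v =
    ((\<Sum>k\<in>{- int N..<int N}. smul (of_real (\<omega> k)) (occ k v)) +
      smul (of_real ((\<mu> - real N - 1 / 2)\<^sup>2 / 2)) v) + energy_term smul a adag b bdag \<omega> v N"
    unfolding sum_symmetric_interval_Suc occ energy_term_def scale_right_diff_distrib
    by (simp only: diff_conv_add_uminus add_ac)
  then show ?case
    unfolding Suc.IH sum.lessThan_Suc by (simp only: add_ac)
qed (simp add: lam)

text \<open>Here particles and holes enter uniformly, so commutators with \<open>L0\<close> reduce
  to those of \<open>occ\<close> and \<open>hop\<close>.\<close>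

lemma L0_cutoff:
  assumes "cutoff N v"
  shows "L0 v = (\<Sum>k\<in>{- int N..<int N}. smul (of_real (\<omega> k)) (occ k v)) +
     smul (of_real ((\<mu> - real N - 1 / 2)\<^sup>2 / 2)) v"
  unfolding energy_sum L0_def
  using Sum_any.expand_superset[OF finite_lessThan energy_term_cutoff[OF assms]] by simp

text \<open>The operator is known only window by window, so one window is chosen that serves all
  vectors involved; there it is a finite sum of linear maps.\<close>

lemma Lp_linear: "Lp (x + y) = Lp x + Lp y" "Lp (smul z x) = smul z (Lp x)"
proof -
  have "\<forall>\<^sub>F N in sequentially. cutoff N x \<and> cutoff N y \<and> cutoff N (x + y) \<and> cutoff N (smul z x)"
    by (intro eventually_conj eventually_cutoff)
  then obtain N where "cutoff N x" "cutoff N y" "cutoff N (x + y)" "cutoff N (smul z x)"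
    by (auto simp: eventually_sequentially)
  then show "Lp (x + y) = Lp x + Lp y" "Lp (smul z x) = smul z (Lp x)"
    by (simp_all add: Lp hop_simps scale_right_distrib sum.distrib scale_sum_right mult.commute)
qed

lemma Lm_linear: "Lm (x + y) = Lm x + Lm y" "Lm (smul z x) = smul z (Lm x)"
proof -
  have "\<forall>\<^sub>F N in sequentially. cutoff N x \<and> cutoff N y \<and> cutoff N (x + y) \<and> cutoff N (smul z x)"
    by (intro eventually_conj eventually_cutoff)
  then obtain N where N: "cutoff N x" "cutoff N y" "cutoff N (x + y)" "cutoff N (smul z x)"
    by (auto simp: eventually_sequentially)
  show "Lm (x + y) = Lm x + Lm y" "Lm (smul z x) = smul z (Lm x)"
    unfolding Lm[OF N(1)] Lm[OF N(2)] Lm[OF N(3)] Lm[OF N(4)] hop_simps scale_right_distrib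
      sum.distrib scale_sum_right scale_scale
    by (simp_all only: mult.commute)
qed

lemma L0_linear: "L0 (x + y) = L0 x + L0 y" "L0 (smul z x) = smul z (L0 x)"
proof -
  have "\<forall>\<^sub>F N in sequentially. cutoff N x \<and> cutoff N y \<and> cutoff N (x + y) \<and> cutoff N (smul z x)"
    by (intro eventually_conj eventually_cutoff)
  then obtain N where N: "cutoff N x" "cutoff N y" "cutoff N (x + y)" "cutoff N (smul z x)"
    by (auto simp: eventually_sequentially)
  then show "L0 (x + y) = L0 x + L0 y"
    by (simp add: L0_cutoff hop_simps scale_right_distrib sum.distrib add_ac)
  show "L0 (smul z x) = smul z (L0 x)"
    unfolding L0_cutoff[OF N(1)] L0_cutoff[OF N(4)] hop_simps scale_right_distrib scale_sum_right scale_scale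
    by (simp only: mult.commute)
qed

lemma ip_Lp: "ip (Lp x) y = - ip x (Lm y)"
proof -
  have "\<forall>\<^sub>F N in sequentially. cutoff N x \<and> cutoff N y"
    by (intro eventually_conj eventually_cutoff)
  then obtain N where "cutoff N x" "cutoff N y"
    by (auto simp: eventually_sequentially)
  then show ?thesis
    by (simp add: Lp Lm ip_sum_left ip_sum_right ip_scale_left ip_scale_right ip_hop sum_negf
        ip_minus_right)
qed

lemma ip_L0: "ip (L0 x) y = ip x (L0 y)"
proof -
  have "\<forall>\<^sub>F N in sequentially. cutoff N x \<and> cutoff N y"
    by (intro eventually_conj eventually_cutoff)
  then obtain N where N: "cutoff N x" "cutoff N y"
    by (auto simp: eventually_sequentially)
  show ?thesis
    unfolding L0_cutoff[OF N(1)] L0_cutoff[OF N(2)] ip_add_left ip_add_right ip_sum_left ip_sum_right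
      ip_scale_left ip_scale_right ip_occ complex_cnj_complex_of_real ..
qed

text \<open>Abel summation, where the recursion makes \<open>2 * \<omega> k\<close> the increment of
  \<open>P\<close>. Both boundary terms stay explicit, as they move when the window grows; a cutoff
  evaluates them later.\<close>

lemma occ_summation_by_parts:
  fixes P :: "int \<Rightarrow> real"
  assumes P: "\<And>k. P k = P (k - 1) + 2 * \<omega> k"
  shows "(\<Sum>k\<in>{- int N..<int N}. smul (of_real (P k)) (occ k v - occ (k + 1) v)) =
    smul 2 (\<Sum>k\<in>{- int N..<int N}. smul (of_real (\<omega> k)) (occ k v)) +
    smul (of_real (P (- int N - 1))) (occ (- int N) v) - smul (of_real (P (int N - 1))) (occ (int N) v)"
proof (induction N)
  case (Suc N)
  have idx0: "- 2 - int N = - int N - 2"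
    by simp
  have "of_real (P (int N)) = of_real (P (int N - 1)) + 2 * (of_real (\<omega> (int N)) :: complex)"
    "of_real (P (- int N - 1)) = of_real (P (- int N - 2)) + 2 * (of_real (\<omega> (- int N - 1)) :: complex)"
    using arg_cong[OF P[of "int N"], of complex_of_real]
      arg_cong[OF P[of "- int N - 1"], of complex_of_real] idx0 by simp_all
  then have P': "smul (of_real (P (int N))) x =
      smul (of_real (P (int N - 1))) x + smul 2 (smul (of_real (\<omega> (int N))) x)"
    "smul (of_real (P (- int N - 1))) x =
      smul (of_real (P (- int N - 2))) x + smul 2 (smul (of_real (\<omega> (- int N - 1))) x)" for x
    by (simp_all add: scale_left_distrib)
  have idx: "- int (Suc N) - 1 = - int N - 2" "- int (Suc N) = - int N - 1" "int (Suc N) - 1 = int N"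
    "- int N - 1 + 1 = - int N" "int (Suc N) = int N + 1"
    by simp_all
  have "(\<Sum>k\<in>{- int (Suc N)..<int (Suc N)}. smul (of_real (P k)) (occ k v - occ (k + 1) v)) =
    smul 2 (\<Sum>k\<in>{- int N..<int N}. smul (of_real (\<omega> k)) (occ k v)) +
    smul (of_real (P (- int N - 1))) (occ (- int N) v) - smul (of_real (P (int N - 1))) (occ (int N) v)
    + (smul (of_real (P (int N))) (occ (int N) v) - smul (of_real (P (int N))) (occ (int N + 1) v))
    + (smul (of_real (P (- int N - 1))) (occ (- int N - 1) v) - smul (of_real (P (- int N - 1))) (occ (- int N) v))"
    unfolding sum_symmetric_interval_Suc Suc.IH by (simp add: scale_right_diff_distrib)
  also have "\<dots> = smul 2 (\<Sum>k\<in>{- int (Suc N)..<int (Suc N)}. smul (of_real (\<omega> k)) (occ k v)) +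
    smul (of_real (P (- int (Suc N) - 1))) (occ (- int (Suc N)) v) -
    smul (of_real (P (int (Suc N) - 1))) (occ (int (Suc N)) v)"
    unfolding sum_symmetric_interval_Suc
    unfolding idx scale_right_distrib P'(1)[of "occ (int N) v"]
      P'(2)[of "occ (- int N - 1) v"]
    by (simp add: idx0)
  finally show ?case .
qed simp

lemma commutator_Lp_Lm: "Lp (Lm v) - Lm (Lp v) = smul 2 (L0 v)"
proof -
  \<comment> \<open>The window must also suit \<open>Lp v\<close> and \<open>Lm v\<close>, on which
    the second charge acts.\<close>
  have "\<forall>\<^sub>F N in sequentially. cutoff N v \<and> cutoff N (Lp v) \<and> cutoff N (Lm v)"
    by (intro eventually_conj eventually_cutoff)
  then obtain N where N: "cutoff N v" "cutoff N (Lp v)" "cutoff N (Lm v)"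
    by (auto simp: eventually_sequentially)
  let ?I = "{- int N..<int N}"
  define P where "P k = (\<omega> k + 1 / 2)\<^sup>2" for k
  have "Lp (Lm v) = (\<Sum>k\<in>?I. smul (p k) (hop k (\<Sum>l\<in>?I. smul (- cnj (p l)) (unhop l v))))"
    unfolding Lp[OF N(3)] unfolding Lm[OF N(1)] ..
  then have 1: "Lp (Lm v) = (\<Sum>k\<in>?I. \<Sum>l\<in>?I. smul (- (p k * cnj (p l))) (hop k (unhop l v)))"
    by (simp only: hop_simps scale_sum_right scale_scale mult_minus_right)
  have "Lm (Lp v) = (\<Sum>l\<in>?I. smul (- cnj (p l)) (unhop l (\<Sum>k\<in>?I. smul (p k) (hop k v))))"
    unfolding Lm[OF N(2)] unfolding Lp[OF N(1)] ..
  also have "\<dots> = (\<Sum>l\<in>?I. \<Sum>k\<in>?I. smul (- (p k * cnj (p l))) (unhop l (hop k v)))"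
    by (simp only: hop_simps scale_sum_right scale_scale mult_minus_left mult_minus_right mult.commute)
  finally have 2: "Lm (Lp v) = (\<Sum>k\<in>?I. \<Sum>l\<in>?I. smul (- (p k * cnj (p l))) (unhop l (hop k v)))"
    by (subst (asm) sum.swap)
  have "Lp (Lm v) - Lm (Lp v) =
      (\<Sum>k\<in>?I. \<Sum>l\<in>?I. smul (- (p k * cnj (p l))) (if k = l then occ (k + 1) v - occ k v else 0))"
    unfolding 1 2 sum_subtractf[symmetric] scale_right_diff_distrib[symmetric] hop_unhop_commutator ..
  also have "\<dots> = (\<Sum>k\<in>?I. smul (- (p k * cnj (p k))) (occ (k + 1) v - occ k v))"
  proof (rule sum.cong[OF refl])
    fix k assume k: "k \<in> ?I"
    have "(\<Sum>l\<in>?I. smul (- (p k * cnj (p l))) (if k = l then occ (k + 1) v - occ k v else 0)) =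
        (\<Sum>l\<in>?I. if k = l then smul (- (p k * cnj (p k))) (occ (k + 1) v - occ k v) else 0)"
      by (intro sum.cong) auto
    then show "(\<Sum>l\<in>?I. smul (- (p k * cnj (p l))) (if k = l then occ (k + 1) v - occ k v else 0)) =
        smul (- (p k * cnj (p k))) (occ (k + 1) v - occ k v)"
      using k by simp
  qed
  also have "\<dots> = (\<Sum>k\<in>?I. smul (of_real (P k)) (occ k v - occ (k + 1) v))"
    by (simp add: p P_def scale_right_diff_distrib)
  \<comment> \<open>The top mode is empty and the bottom mode filled, so
    \<open>P (- int N - 1)\<close> survives as a multiple of the identity: this is the central
    contribution of the sea.\<close>
  also have "\<dots> = smul 2 (\<Sum>k\<in>?I. smul (of_real (\<omega> k)) (occ k v)) + smul (of_real (P (- int N - 1))) v"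
    by (subst occ_summation_by_parts)
      (simp_all add: P_def \<omega> power2_eq_square algebra_simps cutoff_occ[OF N(1)])
  also have "\<dots> = smul 2 (L0 v)"
  proof -
    have "\<omega> (- int N - 1) + 1 / 2 = \<mu> - real N - 1 / 2"
      by (simp add: \<omega>)
    then have "P (- int N - 1) = 2 * ((\<mu> - real N - 1 / 2)\<^sup>2 / 2)"
      by (simp only: P_def)
    then have "of_real (P (- int N - 1)) = 2 * (of_real ((\<mu> - real N - 1 / 2)\<^sup>2 / 2) :: complex)"
      by (simp only: of_real_mult of_real_numeral)
    then show ?thesis
      by (simp only: L0_cutoff[OF N(1)] scale_right_distrib scale_scale)
  qed
  finally show ?thesis .
qed

lemma commutator_L0_Lp: "L0 (Lp v) - Lp (L0 v) = Lp v"
proof -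
  have "\<forall>\<^sub>F N in sequentially. cutoff N v \<and> cutoff N (Lp v) \<and> cutoff N (L0 v)"
    by (intro eventually_conj eventually_cutoff)
  then obtain N where N: "cutoff N v" "cutoff N (Lp v)" "cutoff N (L0 v)"
    by (auto simp: eventually_sequentially)
  \<comment> \<open>\<open>L0\<close> uses a window wider by one, because a hop with
    \<open>l\<close> in \<open>?I\<close> also touches mode \<open>l + 1\<close>, which may equal
    \<open>int N\<close>.\<close>
  have N': "cutoff (Suc N) v" "cutoff (Suc N) (Lp v)"
    using N cutoff_mono by (meson le_SucI order_refl)+
  let ?I = "{- int N..<int N}"
  let ?J = "{- int (Suc N)..<int (Suc N)}"
  let ?w = "smul (of_real ((\<mu> - real (Suc N) - 1 / 2)\<^sup>2 / 2))"
  have "L0 (Lp v) = (\<Sum>k\<in>?J. smul (of_real (\<omega> k)) (occ k (\<Sum>l\<in>?I. smul (p l) (hop l v)))) + ?w (Lp v)"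
    unfolding L0_cutoff[OF N'(2)] unfolding Lp[OF N(1)] ..
  also have "(\<Sum>k\<in>?J. smul (of_real (\<omega> k)) (occ k (\<Sum>l\<in>?I. smul (p l) (hop l v)))) =
      (\<Sum>k\<in>?J. \<Sum>l\<in>?I. smul (p l * of_real (\<omega> k)) (occ k (hop l v)))"
    by (simp only: hop_simps scale_sum_right scale_scale mult.commute)
  also have "\<dots> = (\<Sum>l\<in>?I. \<Sum>k\<in>?J. smul (p l * of_real (\<omega> k)) (occ k (hop l v)))"
    by (rule sum.swap)
  finally have 1: "L0 (Lp v) = (\<Sum>l\<in>?I. \<Sum>k\<in>?J. smul (p l * of_real (\<omega> k)) (occ k (hop l v))) + ?w (Lp v)" .
  have "Lp (L0 v) = (\<Sum>l\<in>?I. smul (p l) (hop l (\<Sum>k\<in>?J. smul (of_real (\<omega> k)) (occ k v)))) +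
      (\<Sum>l\<in>?I. smul (p l) (hop l (?w v)))"
    unfolding Lp[OF N(3)] unfolding L0_cutoff[OF N'(1)] hop_simps(1) scale_right_distrib sum.distrib ..
  also have "(\<Sum>l\<in>?I. smul (p l) (hop l (?w v))) = ?w (Lp v)"
    by (simp only: Lp[OF N(1)] hop_simps scale_sum_right scale_scale mult.commute)
  also have "(\<Sum>l\<in>?I. smul (p l) (hop l (\<Sum>k\<in>?J. smul (of_real (\<omega> k)) (occ k v)))) =
      (\<Sum>l\<in>?I. \<Sum>k\<in>?J. smul (p l * of_real (\<omega> k)) (hop l (occ k v)))"
    by (simp only: hop_simps scale_sum_right scale_scale)
  finally have "L0 (Lp v) - Lp (L0 v) = (\<Sum>l\<in>?I. \<Sum>k\<in>?J. smul (p l * of_real (\<omega> k))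
      (occ k (hop l v) - hop l (occ k v)))"
    unfolding 1 by (simp add: sum_subtractf scale_right_diff_distrib)
  also have "\<dots> = (\<Sum>l\<in>?I. smul (p l) (hop l v))"
  proof (rule sum.cong[OF refl])
    fix l assume l: "l \<in> ?I"
    have "(\<Sum>k\<in>?J. smul (p l * of_real (\<omega> k)) (occ k (hop l v) - hop l (occ k v))) =
        (\<Sum>k\<in>?J. if k = l + 1 then smul (p l * of_real (\<omega> (l + 1))) (hop l v) else 0) -
        (\<Sum>k\<in>?J. if k = l then smul (p l * of_real (\<omega> l)) (hop l v) else 0)"
      unfolding occ_hop_commutator sum_subtractf[symmetric] by (intro sum.cong) auto
    also have "\<dots> = smul (p l * of_real (\<omega> (l + 1)) - p l * of_real (\<omega> l)) (hop l v)"
      using l by (simp add: scale_left_diff_distrib)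
    also have "p l * of_real (\<omega> (l + 1)) - p l * of_real (\<omega> l) = p l"
      by (simp add: \<omega> algebra_simps)
    finally show "(\<Sum>k\<in>?J. smul (p l * of_real (\<omega> k)) (occ k (hop l v) - hop l (occ k v))) =
      smul (p l) (hop l v)" .
  qed
  also have "\<dots> = Lp v"
    by (rule Lp[OF N(1), symmetric])
  finally show ?thesis .
qed

text \<open>The adjoint of \<open>commutator_L0_Lp\<close>: \<open>L0\<close> is symmetric and the
  adjoint of \<open>Lm\<close> is \<open>- Lp\<close>.\<close>

lemma commutator_L0_Lm: "L0 (Lm v) - Lm (L0 v) = - Lm v"
proof (rule eq_if_ip_eq)
  fix y
  have ip_Lm: "ip (Lm x) y = - ip x (Lp y)" for x y
    using ip_Lp[of y x] ip_hermitian[of "Lm x" y] ip_hermitian[of x "Lp y"] by simp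
  have "ip v (Lp y) = ip v (L0 (Lp y)) - ip v (Lp (L0 y))"
    by (metis commutator_L0_Lp ip_diff_right)
  then show "ip (L0 (Lm v) - Lm (L0 v)) y = ip (- Lm v) y"
    by (simp add: ip_diff_left ip_minus_left ip_L0 ip_Lm)
qed

lemma energy_term_vac: "energy_term smul a adag b bdag \<omega> vac j = 0"
  by (simp add: energy_term_def vac_annihilated linear_ops_simps)

lemma L0_vac: "L0 vac = smul (of_real lam) vac"
  by (simp add: L0_def energy_term_vac)

text \<open>In the window of size one both terms begin by removing a particle, with
  \<open>a 0\<close> or \<open>a 1\<close>. The raising charge, by contrast, contains
  \<open>adag 0 (bdag 0 vac)\<close> with squared coefficient
  \<open>(\<mu> - 1/2)\<^sup>2 = 2 * lam\<close>.\<close>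

lemma Lm_vac: "Lm vac = 0"
proof -
  have "cutoff 1 vac"
    unfolding cutoff_def field_coeff_def by (auto simp: vac_annihilated)
  moreover have "{- 1..<1::int} = {- 1, 0}"
    by auto
  ultimately show ?thesis
    by (simp add: Lm unhop_def field_coeff_def vac_annihilated linear_ops_simps)
qed

lemma vac_nonzero: "vac \<noteq> 0"
  using vac_unit by auto

lemma lowest_weight_rep_vac:
  assumes "0 < lam"
  shows "lowest_weight_rep \<lparr>rep_scale = smul, rep_ip = ip, rep_space = UNIV,
    rep_L0 = L0, rep_Lp = Lp, rep_Lm = Lm\<rparr> lam vac" (is "lowest_weight_rep ?F lam vac")
proof -
  have cis: "complex_inner_space (rep_scale ?F) (rep_ip ?F)"
    using complex_inner_space_axioms by simp
  moreover have "unitary_sl2_rep ?F"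
    using cis unfolding unitary_sl2_rep_def invariant_subspace_def linear_map_on_def
    by (simp add: Lp_linear Lm_linear L0_linear commutator_Lp_Lm commutator_L0_Lp commutator_L0_Lm
        ip_Lp ip_L0)
  moreover have "lowest_weight_vector ?F lam vac"
    by (simp add: lowest_weight_vector_def L0_eigenspace_def L0_vac Lm_vac vac_nonzero)
  ultimately show ?thesis
    using assms by (intro lowest_weight_rep.intro lowest_weight_rep_axioms.intro)
qed

end

section \<open>The vacuum representation\<close>

theorem mainTheorem7:
  fixes \<beta>p \<beta>m \<beta> \<mu> lam t :: real
    and \<omega> :: "int \<Rightarrow> real"
    and \<Phi> :: "int \<Rightarrow> real \<Rightarrow> complex^2"
    and \<Psi> :: "int \<Rightarrow> real \<Rightarrow> real \<Rightarrow> complex^2"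
    and smul :: "complex \<Rightarrow> 'v::ab_group_add \<Rightarrow> 'v"
    and ip :: "'v \<Rightarrow> 'v \<Rightarrow> complex"
    and a adag b bdag :: "nat \<Rightarrow> 'v \<Rightarrow> 'v"
    and vac :: 'v
    and Lp Lm :: "'v \<Rightarrow> 'v"
  assumes "0 \<le> \<beta>p" "\<beta>p < pi" "0 \<le> \<beta>m" "\<beta>m < pi"
    and "\<beta> = (\<beta>p + \<beta>m) / pi"
    and "\<beta> \<notin> {of_int k / 2 | k::int. True} \<or>
         (0 \<notin> {of_int j - \<beta> | j::int. True} \<and> 1 / 2 \<notin> {of_int j - \<beta> | j::int. True})"
    and "lowest_positive_frequency \<beta>p \<beta>m \<mu>" "0 < \<mu>" "\<mu> < 1" "\<mu> \<noteq> 1 / 2"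
    and "lam = (\<mu> - 1 / 2)\<^sup>2 / 2"
    and "\<And>j. \<omega> j = \<mu> + of_int j"
    and "\<And>j. dirac_eigenfunction \<beta>p \<beta>m (\<omega> j) (\<Phi> j)"
    and "\<And>j. \<Psi> j = mode (\<omega> j) (\<Phi> j)"
    and "\<And>j. spinor_ip t (\<Psi> j) (\<Psi> j) = 1"
    and "fermionic_fock smul ip a adag b bdag vac"
    and "Lp = charge smul a adag b bdag t \<Psi> L_plus"
    and "Lm = charge smul a adag b bdag t \<Psi> L_minus"
  shows
    \<comment> \<open>the sums defining the charges are finite on every Fock vector\<close>
    "(\<forall>v. finite {jk. charge_term smul a adag b bdag t \<Psi> L_plus v jk \<noteq> 0}) \<and>
     (\<forall>v. finite {jk. charge_term smul a adag b bdag t \<Psi> L_minus v jk \<noteq> 0}) \<and>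
     (\<forall>v. finite {j. energy_term smul a adag b bdag \<omega> v j \<noteq> 0}) \<and>
     (\<exists>L0.
       (\<forall>v. Lp (Lm v) - Lm (Lp v) = smul 2 (L0 v)) \<and>
       (\<forall>v. L0 v = Sum_any (energy_term smul a adag b bdag \<omega> v) + smul (of_real lam) v) \<and>
       L0 vac = smul (of_real lam) vac \<and>
       Lm vac = 0 \<and>
       (let F = \<lparr>rep_scale = smul, rep_ip = ip, rep_space = UNIV,
                 rep_L0 = L0, rep_Lp = Lp, rep_Lm = Lm\<rparr>;
            G = generated_rep F vac
        in \<not> invariant_vector F vac \<and>
           discrete_series_plus lam G \<and>
           lowest_weight_vector G lam vac \<and>
           (\<forall>D :: 'w::ab_group_add sl2_rep. discrete_series_plus lam D \<longrightarrow>
              (\<exists>U. unitary_equivalence G D U \<and> lowest_weight_vector D lam (U vac)))))"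
proof -
  obtain p where p_plus: "\<And>j k. spinor_ip t (\<Psi> j) (L_plus (\<Psi> k)) = (if j = k + 1 then p k else 0)"
    and p_minus: "\<And>j k. spinor_ip t (\<Psi> j) (L_minus (\<Psi> k)) = (if k = j + 1 then - cnj (p j) else 0)"
    and p_norm: "\<And>k. p k * cnj (p k) = of_real ((\<omega> k + 1 / 2)\<^sup>2)"
    using mode_matrix_elements[OF assms(12) assms(13) assms(14) assms(15)] by metis
  interpret fermionic_fock smul ip a adag b bdag vac
    by (rule assms(16))
  have "\<exists>N. cutoff N v" for v
    using eventually_cutoff[of v] by (auto simp: eventually_sequentially)
  then have finite_terms: "finite {jk. charge_term smul a adag b bdag t \<Psi> L_plus v jk \<noteq> 0}"
    "finite {jk. charge_term smul a adag b bdag t \<Psi> L_minus v jk \<noteq> 0}"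
    "finite {j. energy_term smul a adag b bdag \<omega> v j \<noteq> 0}" for v
    using charge_plus_cutoff(2)[where L = L_plus, OF p_plus]
      charge_minus_cutoff(2)[where L = L_minus, OF p_minus]
      finite_subset[OF energy_term_cutoff finite_lessThan] by blast+
  interpret fock_charges smul ip a adag b bdag vac p \<omega> \<mu> lam Lp Lm
  proof
    show "lam = (\<mu> - 1 / 2)\<^sup>2 / 2" "\<And>k. \<omega> k = \<mu> + of_int k"
      by (fact assms)+
    show "\<And>k. p k * cnj (p k) = of_real ((\<omega> k + 1 / 2)\<^sup>2)"
      by (fact p_norm)
    fix N v assume "cutoff N v"
    then show "Lp v = (\<Sum>k\<in>{- int N..<int N}. smul (p k) (hop k v))"
      "Lm v = (\<Sum>k\<in>{- int N..<int N}. smul (- cnj (p k)) (unhop k v))"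
      unfolding assms(17,18)
      using charge_plus_cutoff(1)[where L = L_plus, OF p_plus]
        charge_minus_cutoff(1)[where L = L_minus, OF p_minus] by blast+
  qed
  \<comment> \<open>At \<mu> = 1/2 the constant would vanish and the vacuum would be
    invariant.\<close>
  have lam_pos: "0 < lam"
    unfolding assms(11) using assms(10) by simp
  define F where "F = \<lparr>rep_scale = smul, rep_ip = ip, rep_space = UNIV,
    rep_L0 = L0, rep_Lp = Lp, rep_Lm = Lm\<rparr>"
  have rep: "lowest_weight_rep F lam vac"
    unfolding F_def by (rule lowest_weight_rep_vac[OF lam_pos])
  have "\<not> invariant_vector F vac"
    using lam_pos by (simp add: invariant_vector_def F_def L0_vac vac_nonzero)
  moreover have "\<exists>U. unitary_equivalence (generated_rep F vac) D U \<and> lowest_weight_vector D lam (U vac)"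
    if "discrete_series_plus lam D" for D :: "'w sl2_rep"
    using discrete_series_unique[OF rep _ that] by (simp add: F_def vac_unit)
  ultimately have rep_part: "let F = \<lparr>rep_scale = smul, rep_ip = ip, rep_space = UNIV,
                 rep_L0 = L0, rep_Lp = Lp, rep_Lm = Lm\<rparr>;
            G = generated_rep F vac
        in \<not> invariant_vector F vac \<and>
           discrete_series_plus lam G \<and>
           lowest_weight_vector G lam vac \<and>
           (\<forall>D :: 'w sl2_rep. discrete_series_plus lam D \<longrightarrow>
              (\<exists>U. unitary_equivalence G D U \<and> lowest_weight_vector D lam (U vac)))"
    unfolding Let_def F_def[symmetric]
    using lowest_weight_rep.discrete_series_generated[OF rep]
      lowest_weight_rep.lowest_weight_generated[OF rep] by blast
  show ?thesis
    using finite_terms commutator_Lp_Lm L0_def L0_vac Lm_vac rep_part by blast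
qed

end
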